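(* There exists a (real) Banach space $X$ such that (a) $X$ is (linearly) isomorphic to $\ell_1$; (b) $X$ has a strongly unique predual (in particular, $X$ is a dual Banach space); and (c) $X$ has a weak$^*$ closed, $1$-complemented, $1$-codimensional subspace that is linearly isometric to $\ell_1$.
   Context: All scalars are real. For a Banach space $X$, a closed subspace $Y\subset X^*$ is called a predual of $X$ if the mapping $T:X\to Y^*$ given by $\langle Tx,y\rangle=\langle y,x\rangle$ for $x\in X$, $y\in Y$ is a surjective linear isometry. $X$ is a dual Banach space if it has a predual. $X$ has a strongly unique predual if there is exactly one closed subspace $Y\subset X^*$ that is a predual of $X$ (equivalently, $X$ is a dual Banach space and every linear isometry from $X$ onto a dual Banach space $Z^*$ is weak$^*$-to-weak$^*$ continuous). In (c), the weak$^*$ topology on $X$ is $\sigma(X,Y)$, where $Y$ is the unique predual from (b). A subspace $V$ of $X$ is $1$-complemented if there is a bounded linear projection of $X$ onto $V$ of norm $1$. $\ell_1$ carries its usual norm. *)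

theory Defs
  imports "HOL-Analysis.Analysis" "HOL-Library.Function_Algebras"
begin

instantiation "fun" :: (type, real_vector) real_vector
begin

definition scaleR_fun :: "real \<Rightarrow> ('a \<Rightarrow> 'b) \<Rightarrow> 'a \<Rightarrow> 'b" where
  "scaleR_fun c f = (\<lambda>x. c *\<^sub>R f x)"

instance
  by standard (simp_all add: scaleR_fun_def fun_eq_iff scaleR_add_right scaleR_add_left)

end

text \<open>
  HOL cannot quantify existentially over types, so a normed space is represented by a pair
  \<open>S N\<close>: a linear subspace \<open>S\<close> of an ambient type of class \<^class>\<open>real_vector\<close>, and a function
  \<open>N\<close> whose restriction to \<open>S\<close> is the norm. The values of \<open>N\<close> outside
  \<open>S\<close> are irrelevant.
\<close>

definition normed_space :: "'a::real_vector set \<Rightarrow> ('a \<Rightarrow> real) \<Rightarrow> bool" where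
  "normed_space S N \<longleftrightarrow>
     subspace S \<and>
     (\<forall>x\<in>S. 0 \<le> N x) \<and>
     (\<forall>x\<in>S. N x = 0 \<longleftrightarrow> x = 0) \<and>
     (\<forall>c. \<forall>x\<in>S. N (c *\<^sub>R x) = \<bar>c\<bar> * N x) \<and>
     (\<forall>x\<in>S. \<forall>y\<in>S. N (x + y) \<le> N x + N y)"

text \<open>
  The value \<open>0\<close> off \<open>S\<close> is needed because the locale \<^locale>\<open>Metric_space\<close> requires nonnegativity
  and symmetry on the whole type.
\<close>

definition norm_dist :: "'a::real_vector set \<Rightarrow> ('a \<Rightarrow> real) \<Rightarrow> 'a \<Rightarrow> 'a \<Rightarrow> real" where
  "norm_dist S N x y = (if x \<in> S \<and> y \<in> S then N (x - y) else 0)"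

definition banach_space :: "'a::real_vector set \<Rightarrow> ('a \<Rightarrow> real) \<Rightarrow> bool" where
  "banach_space S N \<longleftrightarrow> normed_space S N \<and> Metric_space.mcomplete S (norm_dist S N)"

definition linear_on :: "'a::real_vector set \<Rightarrow> ('a \<Rightarrow> 'b::real_vector) \<Rightarrow> bool" where
  "linear_on S T \<longleftrightarrow>
     (\<forall>x\<in>S. \<forall>y\<in>S. T (x + y) = T x + T y) \<and> (\<forall>c. \<forall>x\<in>S. T (c *\<^sub>R x) = c *\<^sub>R T x)"

definition bounded_linear_on ::
  "'a::real_vector set \<Rightarrow> ('a \<Rightarrow> real) \<Rightarrow> ('b::real_vector \<Rightarrow> real) \<Rightarrow> ('a \<Rightarrow> 'b) \<Rightarrow> bool" where
  "bounded_linear_on S N N' T \<longleftrightarrow> linear_on S T \<and> (\<exists>C. \<forall>x\<in>S. N' (T x) \<le> C * N x)"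

definition op_norm :: "'a set \<Rightarrow> ('a \<Rightarrow> real) \<Rightarrow> ('b \<Rightarrow> real) \<Rightarrow> ('a \<Rightarrow> 'b) \<Rightarrow> real" where
  "op_norm S N N' T = (SUP x\<in>{x \<in> S. N x \<le> 1}. N' (T x))"

definition isomorphic_spaces ::
  "'a::real_vector set \<Rightarrow> ('a \<Rightarrow> real) \<Rightarrow> 'b::real_vector set \<Rightarrow> ('b \<Rightarrow> real) \<Rightarrow> bool" where
  "isomorphic_spaces S N S' N' \<longleftrightarrow>
     (\<exists>T. bij_betw T S S' \<and> bounded_linear_on S N N' T \<and>
          bounded_linear_on S' N' N (inv_into S T))"

definition surj_linear_isometry ::
  "'a::real_vector set \<Rightarrow> ('a \<Rightarrow> real) \<Rightarrow> 'b::real_vector set \<Rightarrow> ('b \<Rightarrow> real) \<Rightarrow> ('a \<Rightarrow> 'b) \<Rightarrow> bool" where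
  "surj_linear_isometry S N S' N' T \<longleftrightarrow>
     linear_on S T \<and> T ` S = S' \<and> (\<forall>x\<in>S. N' (T x) = N x)"

definition isometric_spaces ::
  "'a::real_vector set \<Rightarrow> ('a \<Rightarrow> real) \<Rightarrow> 'b::real_vector set \<Rightarrow> ('b \<Rightarrow> real) \<Rightarrow> bool" where
  "isometric_spaces S N S' N' \<longleftrightarrow> (\<exists>T. surj_linear_isometry S N S' N' T)"

text \<open>
  Functionals on \<open>S\<close> are normalised to vanish off \<open>S\<close>, so that each one is represented by exactly
  one function.
\<close>

definition dual_space :: "'a::real_vector set \<Rightarrow> ('a \<Rightarrow> real) \<Rightarrow> ('a \<Rightarrow> real) set" where
  "dual_space S N = {f. bounded_linear_on S N abs f \<and> (\<forall>x. x \<notin> S \<longrightarrow> f x = 0)}"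

definition dual_norm :: "'a::real_vector set \<Rightarrow> ('a \<Rightarrow> real) \<Rightarrow> ('a \<Rightarrow> real) \<Rightarrow> real" where
  "dual_norm S N f = op_norm S N abs f"

definition eval_on :: "('a \<Rightarrow> real) set \<Rightarrow> 'a \<Rightarrow> ('a \<Rightarrow> real) \<Rightarrow> real" where
  "eval_on Y x = (\<lambda>y. if y \<in> Y then y x else 0)"

definition is_predual :: "'a::real_vector set \<Rightarrow> ('a \<Rightarrow> real) \<Rightarrow> ('a \<Rightarrow> real) set \<Rightarrow> bool" where
  "is_predual S N Y \<longleftrightarrow>
     Y \<subseteq> dual_space S N \<and> subspace Y \<and>
     closedin (Metric_space.mtopology (dual_space S N) (norm_dist (dual_space S N) (dual_norm S N))) Y \<and>
     surj_linear_isometry S N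
       (dual_space Y (dual_norm S N)) (dual_norm Y (dual_norm S N)) (eval_on Y)"

definition has_strongly_unique_predual :: "'a::real_vector set \<Rightarrow> ('a \<Rightarrow> real) \<Rightarrow> bool" where
  "has_strongly_unique_predual S N \<longleftrightarrow> (\<exists>!Y. is_predual S N Y)"

text \<open>The topology \<open>\<sigma>(S, Y)\<close>.\<close>

definition weak_star_topology :: "'a set \<Rightarrow> ('a \<Rightarrow> real) set \<Rightarrow> 'a topology" where
  "weak_star_topology S Y =
     topology_generated_by {{x \<in> S. y x \<in> U} | y U. y \<in> Y \<and> open U}"

definition one_complemented :: "'a::real_vector set \<Rightarrow> ('a \<Rightarrow> real) \<Rightarrow> 'a set \<Rightarrow> bool" where
  "one_complemented S N V \<longleftrightarrow>
     (\<exists>P. bounded_linear_on S N N P \<and> P ` S = V \<and> V \<subseteq> S \<and> (\<forall>x\<in>S. P (P x) = P x) \<and>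
          op_norm S N N P = 1)"

definition has_codimension :: "'a::real_vector set \<Rightarrow> 'a set \<Rightarrow> nat \<Rightarrow> bool" where
  "has_codimension S V n \<longleftrightarrow>
     subspace V \<and> V \<subseteq> S \<and>
     (\<exists>B. finite B \<and> card B = n \<and> independent B \<and> V \<inter> span B = {0} \<and> span (V \<union> B) = S)"

definition l1_space :: "(nat \<Rightarrow> real) set" where
  "l1_space = {x. summable (\<lambda>n. \<bar>x n\<bar>)}"

definition l1_norm :: "(nat \<Rightarrow> real) \<Rightarrow> real" where
  "l1_norm x = (\<Sum>n. \<bar>x n\<bar>)"

end

theory Submission
  imports Defs
begin

text \<open>
  Write an element of \<open>\<ell>\<^sub>1 \<oplus> \<real>\<close> as \<open>(x, t)\<close> and put
  \<open>N(x, t) = max (\<Sum>\<^sub>k \<bar>x\<^sub>k\<bar>) (sup\<^sub>k \<bar>t + x\<^sub>k\<bar>)\<close>. This is a dual norm with respect to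
  \<open>c\<^sub>0 \<oplus> \<real>\<close>, and the hyperplane \<open>t = 0\<close> is an isometric copy of \<open>\<ell>\<^sub>1\<close>, complemented by
  \<open>(x, t) \<mapsto> (x, 0)\<close>. The norm is Frechet differentiable at \<open>(e\<^sub>k, 1)\<close> with derivative
  \<open>p\<^sub>k(x, t) = t + x\<^sub>k\<close>, so every predual, being closed and norming, contains \<open>p\<^sub>k\<close>. The averages
  of the \<open>p\<^sub>k\<close> converge in norm to the functional \<open>t\<close>, so every predual contains all coordinate
  functionals and hence \<open>c\<^sub>0 \<oplus> \<real>\<close>. It cannot be larger, because \<open>c\<^sub>0 \<oplus> \<real>\<close> already separates
  the points of the space.
\<close>

subsection \<open>Normed spaces on carriers and their duals\<close>

lemma scaleR_fun_apply [simp]: "(c *\<^sub>R f) x = c *\<^sub>R f x"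
  by (simp add: scaleR_fun_def)

lemma normed_space_zero:
  assumes "normed_space S N"
  shows "0 \<in> S" "N 0 = 0"
  using assms by (simp_all add: normed_space_def subspace_0)

lemma normed_space_minus:
  assumes "normed_space S N" "x \<in> S" "y \<in> S"
  shows "N (x - y) = N (y - x)"
proof -
  have "N ((-1) *\<^sub>R (y - x)) = \<bar>-1\<bar> * N (y - x)"
    using assms unfolding normed_space_def by (metis subspace_diff)
  then show ?thesis by simp
qed

lemma Metric_space_norm_dist:
  assumes "normed_space S N"
  shows "Metric_space S (norm_dist S N)"
proof
  have sub: "x - y \<in> S" if "x \<in> S" "y \<in> S" for x y
    using assms that by (auto simp: normed_space_def subspace_diff)
  fix x y z
  show "0 \<le> norm_dist S N x y"
    using assms sub by (auto simp: norm_dist_def normed_space_def)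
  show "norm_dist S N x y = norm_dist S N y x"
    using normed_space_minus[OF assms] by (auto simp: norm_dist_def)
  show "norm_dist S N x y = 0 \<longleftrightarrow> x = y" if "x \<in> S" "y \<in> S"
    using assms sub that by (auto simp: norm_dist_def normed_space_def)
  show "norm_dist S N x z \<le> norm_dist S N x y + norm_dist S N y z"
    if "x \<in> S" "y \<in> S" "z \<in> S"
  proof -
    have "N (u + v) \<le> N u + N v" if "u \<in> S" "v \<in> S" for u v
      using assms that by (simp add: normed_space_def)
    from this[OF sub[OF that(1,2)] sub[OF that(2,3)]]
    have "N ((x - y) + (y - z)) \<le> N (x - y) + N (y - z)" .
    then show ?thesis using that by (simp add: norm_dist_def)
  qed
qed

lemma normed_space_subset:
  assumes "normed_space S N" "Y \<subseteq> S" "subspace Y"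
  shows "normed_space Y N"
  using assms(1) subsetD[OF assms(2)] assms(3) by (simp add: normed_space_def)

text \<open>A point outside a closed set has a ball disjoint from it; contraposition turns
  closedness into stability under norm approximation.\<close>

lemma closedin_norm_dist_iff:
  assumes "normed_space S N"
  shows "closedin (Metric_space.mtopology S (norm_dist S N)) Y \<longleftrightarrow>
    Y \<subseteq> S \<and> (\<forall>f\<in>S. (\<forall>e>0. \<exists>g\<in>Y. N (f - g) < e) \<longrightarrow> f \<in> Y)"
proof -
  interpret Metric_space S "norm_dist S N"
    by (rule Metric_space_norm_dist[OF assms])
  have "disjnt Y (mball f r) \<longleftrightarrow> (\<forall>g\<in>Y. \<not> N (f - g) < r)" if "Y \<subseteq> S" "f \<in> S" for f r
    using that by (auto simp: disjnt_iff in_mball norm_dist_def)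
  then show ?thesis
    unfolding closedin_metric by blast
qed

lemma dual_norm_le:
  assumes "normed_space S N" "0 \<le> C" "\<And>x. x \<in> S \<Longrightarrow> \<bar>f x\<bar> \<le> C * N x"
  shows "dual_norm S N f \<le> C"
  unfolding dual_norm_def op_norm_def
proof (rule cSUP_least)
  show "{x \<in> S. N x \<le> 1} \<noteq> {}"
    using normed_space_zero[OF assms(1)] by force
  show "\<bar>f x\<bar> \<le> C" if "x \<in> {x \<in> S. N x \<le> 1}" for x
    using assms(3)[of x] mult_left_mono[of "N x" 1 C] assms(2) that by auto
qed

lemma dual_norm_upper:
  assumes "normed_space S N" "f \<in> dual_space S N" "x \<in> S" "N x \<le> 1"
  shows "\<bar>f x\<bar> \<le> dual_norm S N f"
  unfolding dual_norm_def op_norm_def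
proof (rule cSUP_upper)
  obtain C where C: "\<And>x. x \<in> S \<Longrightarrow> \<bar>f x\<bar> \<le> C * N x"
    using assms(2) by (auto simp: dual_space_def bounded_linear_on_def)
  \<comment> \<open>The constant witnessing boundedness may be negative, so its absolute value
    serves as the bound on the unit ball.\<close>
  have "\<bar>f y\<bar> \<le> \<bar>C\<bar>" if "y \<in> S" "N y \<le> 1" for y
  proof -
    have "0 \<le> N y" using assms(1) that by (simp add: normed_space_def)
    then have "C * N y \<le> \<bar>C\<bar> * 1" using that by (intro mult_mono) auto
    then show ?thesis using C[OF that(1)] by linarith
  qed
  then show "bdd_above ((\<lambda>x. \<bar>f x\<bar>) ` {x \<in> S. N x \<le> 1})"
    by (intro bdd_aboveI2[where M = "\<bar>C\<bar>"]) auto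
qed (use assms in auto)

text \<open>Scaling \<open>x\<close> to norm 1 reduces this to the supremum over the unit ball. If
  \<open>N x = 0\<close>, boundedness alone forces \<open>f x = 0\<close>.\<close>

lemma dual_norm_bound:
  assumes "normed_space S N" "f \<in> dual_space S N" "x \<in> S"
  shows "\<bar>f x\<bar> \<le> dual_norm S N f * N x"
proof (cases "N x = 0")
  case True
  then show ?thesis
    using assms by (fastforce simp: dual_space_def bounded_linear_on_def)
next
  case False
  then have pos: "N x > 0"
    using assms by (fastforce simp: normed_space_def less_le)
  let ?u = "(1 / N x) *\<^sub>R x"
  have "?u \<in> S"
    using assms by (auto simp: normed_space_def subspace_scale)
  moreover have "N ?u \<le> 1"
    using assms pos by (auto simp: normed_space_def)
  ultimately have "\<bar>f ?u\<bar> \<le> dual_norm S N f"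
    by (rule dual_norm_upper[OF assms(1,2)])
  moreover have "f ?u = f x / N x"
    using assms by (auto simp: dual_space_def bounded_linear_on_def linear_on_def)
  ultimately show ?thesis
    using pos by (simp add: abs_div field_simps)
qed

lemma dual_norm_nonneg:
  assumes "normed_space S N" "f \<in> dual_space S N"
  shows "0 \<le> dual_norm S N f"
proof -
  have "\<bar>f 0\<bar> \<le> dual_norm S N f"
    using assms normed_space_zero[OF assms(1)] by (intro dual_norm_upper) auto
  then show ?thesis by linarith
qed

lemma dual_space_apply:
  assumes "f \<in> dual_space S N"
  shows "x \<in> S \<Longrightarrow> y \<in> S \<Longrightarrow> f (x + y) = f x + f y"
    and "x \<in> S \<Longrightarrow> f (c *\<^sub>R x) = c * f x"
    and "x \<notin> S \<Longrightarrow> f x = 0"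
  using assms by (auto simp: dual_space_def bounded_linear_on_def linear_on_def)

lemma dual_spaceI:
  assumes "\<And>x y. x \<in> S \<Longrightarrow> y \<in> S \<Longrightarrow> f (x + y) = f x + f y"
    and "\<And>c x. x \<in> S \<Longrightarrow> f (c *\<^sub>R x) = c * f x"
    and "\<And>x. x \<in> S \<Longrightarrow> \<bar>f x\<bar> \<le> C * N x"
    and "\<And>x. x \<notin> S \<Longrightarrow> f x = 0"
  shows "f \<in> dual_space S N"
  using assms unfolding dual_space_def bounded_linear_on_def linear_on_def
  by (auto intro!: exI[of _ C])

lemma dual_space_diff:
  assumes "normed_space S N" "f \<in> dual_space S N" "x \<in> S" "y \<in> S"
  shows "f (x - y) = f x - f y"
proof -
  have "x - y \<in> S" using assms by (auto simp: normed_space_def subspace_diff)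
  then show ?thesis
    using dual_space_apply(1)[OF assms(2), of "x - y" y] assms(4) by simp
qed

lemma subspace_dual_space:
  assumes "normed_space S N"
  shows "subspace (dual_space S N)"
proof (rule subspaceI)
  show "0 \<in> dual_space S N"
    by (rule dual_spaceI[where C = 0]) auto
next
  fix f g assume fg: "f \<in> dual_space S N" "g \<in> dual_space S N"
  have "\<bar>(f + g) x\<bar> \<le> (dual_norm S N f + dual_norm S N g) * N x" if "x \<in> S" for x
    using dual_norm_bound[OF assms fg(1) that] dual_norm_bound[OF assms fg(2) that]
    by (simp add: distrib_right)
  then show "f + g \<in> dual_space S N"
    by (intro dual_spaceI)
      (auto simp: dual_space_apply[OF fg(1)] dual_space_apply[OF fg(2)] distrib_left)
next
  fix c f assume f: "f \<in> dual_space S N"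
  have "\<bar>(c *\<^sub>R f) x\<bar> \<le> (\<bar>c\<bar> * dual_norm S N f) * N x" if "x \<in> S" for x
    using dual_norm_bound[OF assms f that]
    by (simp add: abs_mult mult.assoc mult_left_mono)
  then show "c *\<^sub>R f \<in> dual_space S N"
    by (intro dual_spaceI) (auto simp: dual_space_apply[OF f] distrib_left)
qed

lemma normed_space_dual:
  assumes "normed_space S N"
  shows "normed_space (dual_space S N) (dual_norm S N)"
proof -
  note bound = dual_norm_bound[OF assms] and nonneg = dual_norm_nonneg[OF assms]
  have "dual_norm S N f = 0 \<longleftrightarrow> f = 0" if f: "f \<in> dual_space S N" for f
  proof
    assume "dual_norm S N f = 0"
    then show "f = 0"
      using bound[OF f] dual_space_apply(3)[OF f] by (fastforce simp: fun_eq_iff)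
  next
    assume "f = 0"
    then have "dual_norm S N f \<le> 0"
      by (intro dual_norm_le[OF assms]) auto
    then show "dual_norm S N f = 0"
      using nonneg[OF f] by simp
  qed
  moreover have le: "dual_norm S N (c *\<^sub>R f) \<le> \<bar>c\<bar> * dual_norm S N f"
    if f: "f \<in> dual_space S N" for c f
    using bound[OF f] nonneg[OF f]
    by (intro dual_norm_le[OF assms]) (auto simp: abs_mult mult.assoc mult_left_mono)
  have "dual_norm S N (c *\<^sub>R f) = \<bar>c\<bar> * dual_norm S N f" if f: "f \<in> dual_space S N" for c f
  proof (cases "c = 0")
    case True
    then show ?thesis
      using le[OF f, of c] nonneg[of "c *\<^sub>R f"] f subspace_scale[OF subspace_dual_space[OF assms] f, of c]
      by simp
  next
    case False
    have cf: "c *\<^sub>R f \<in> dual_space S N"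
      by (rule subspace_scale[OF subspace_dual_space[OF assms] f])
    \<comment> \<open>The reverse inequality is the one just shown, applied to
      \<open>c *\<^sub>R f\<close> with the factor \<open>1 / c\<close>.\<close>
    have "dual_norm S N f \<le> \<bar>1 / c\<bar> * dual_norm S N (c *\<^sub>R f)"
      using le[OF cf, of "1 / c"] False by simp
    then show ?thesis
      using le[OF f, of c] False by (simp add: field_simps)
  qed
  moreover have "dual_norm S N (f + g) \<le> dual_norm S N f + dual_norm S N g"
    if fg: "f \<in> dual_space S N" "g \<in> dual_space S N" for f g
  proof (rule dual_norm_le[OF assms])
    show "0 \<le> dual_norm S N f + dual_norm S N g"
      using nonneg[OF fg(1)] nonneg[OF fg(2)] by simp
    show "\<bar>(f + g) x\<bar> \<le> (dual_norm S N f + dual_norm S N g) * N x" if "x \<in> S" for x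
      using bound[OF fg(1) that] bound[OF fg(2) that] by (simp add: distrib_right)
  qed
  ultimately show ?thesis
    using subspace_dual_space[OF assms] nonneg by (simp add: normed_space_def)
qed

section \<open>Evaluation functionals, and preduals as closed norming subspaces\<close>

lemma eval_on_bound:
  assumes "normed_space S N" "Y \<subseteq> dual_space S N" "x \<in> S" "y \<in> Y"
  shows "\<bar>eval_on Y x y\<bar> \<le> N x * dual_norm S N y"
  using dual_norm_bound[OF assms(1), of y x] assms(2-4) by (auto simp: eval_on_def mult.commute)

lemma eval_on_mem_dual:
  assumes "normed_space S N" "Y \<subseteq> dual_space S N" "subspace Y" "x \<in> S"
  shows "eval_on Y x \<in> dual_space Y (dual_norm S N)"
  by (rule dual_spaceI[where C = "N x"])
    (use eval_on_bound[OF assms(1,2,4)] subspace_add[OF assms(3)] subspace_scale[OF assms(3)]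
      in \<open>auto simp: eval_on_def\<close>)

text \<open>Closedness with a non-strict estimate, the form in which \<open>dual_norm_le\<close>
  delivers bounds; halving \<open>e\<close> restores strictness.\<close>

lemma predual_closed:
  assumes "normed_space S N" "is_predual S N Y" "f \<in> dual_space S N"
    and "\<And>e. e > 0 \<Longrightarrow> \<exists>g\<in>Y. dual_norm S N (f - g) \<le> e"
  shows "f \<in> Y"
proof -
  have "\<exists>g\<in>Y. dual_norm S N (f - g) < e" if "e > 0" for e
    using assms(4)[of "e / 2"] that by force
  then show ?thesis
    using assms(2,3) closedin_norm_dist_iff[OF normed_space_dual[OF assms(1)]]
    unfolding is_predual_def by blast
qed

text \<open>Evaluation on \<open>Y\<close> is isometric, so \<open>N x\<close> is the supremum of
  \<open>\<bar>y x\<bar>\<close> over the unit ball of \<open>Y\<close>. Passing to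
  \<open>- y\<close> where necessary removes the absolute value.\<close>

lemma predual_norming:
  assumes "normed_space S N" "is_predual S N Y" "x \<in> S" "e > 0"
  obtains y where "y \<in> Y" "dual_norm S N y \<le> 1" "y x \<ge> N x - e"
proof -
  have Y: "Y \<subseteq> dual_space S N" "subspace Y"
    using assms(2) by (auto simp: is_predual_def)
  have nY: "normed_space Y (dual_norm S N)"
    using normed_space_subset[OF normed_space_dual[OF assms(1)]] Y by blast
  have eq: "dual_norm Y (dual_norm S N) (eval_on Y x) = N x"
    using assms(2,3) by (auto simp: is_predual_def surj_linear_isometry_def)
  have "\<exists>y\<in>{y \<in> Y. dual_norm S N y \<le> 1}. \<bar>eval_on Y x y\<bar> \<ge> N x - e"
  proof (rule ccontr)
    assume "\<not> ?thesis"
    then have "\<bar>eval_on Y x y\<bar> \<le> N x - e" if "y \<in> {y \<in> Y. dual_norm S N y \<le> 1}" for y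
      using that by force
    moreover have "0 \<in> {y \<in> Y. dual_norm S N y \<le> 1}"
      using normed_space_zero[OF nY] by simp
    ultimately have "op_norm Y (dual_norm S N) abs (eval_on Y x) \<le> N x - e"
      unfolding op_norm_def by (intro cSUP_least) auto
    then show False
      using eq \<open>e > 0\<close> by (simp add: dual_norm_def)
  qed
  then obtain y where y: "y \<in> Y" "dual_norm S N y \<le> 1" "\<bar>y x\<bar> \<ge> N x - e"
    by (auto simp: eval_on_def)
  show thesis
  proof (cases "y x \<ge> 0")
    case True
    then show thesis using y that by auto
  next
    case False
    have "- y \<in> Y" using subspace_neg[OF Y(2) y(1)] .
    moreover have "dual_norm S N (- y) = dual_norm S N y"
      by (simp add: dual_norm_def op_norm_def)
    ultimately show thesis using y False that[of "- y"] by auto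
  qed
qed

subsection \<open>The space \<open>\<ell>\<^sub>1\<close> and its renorming\<close>

lemma subspace_l1: "subspace l1_space"
proof (rule subspaceI)
  fix x y assume "x \<in> l1_space" "y \<in> l1_space"
  then have "summable (\<lambda>n. \<bar>x n\<bar> + \<bar>y n\<bar>)"
    by (auto simp: l1_space_def intro: summable_add)
  then show "x + y \<in> l1_space"
    unfolding l1_space_def by (auto intro: summable_comparison_test')
qed (auto simp: l1_space_def abs_mult intro: summable_mult)

lemma l1_summable: "z \<in> l1_space \<Longrightarrow> summable (\<lambda>n. \<bar>z n\<bar>)"
  by (simp add: l1_space_def)

lemma l1_summable_Suc: "z \<in> l1_space \<Longrightarrow> summable (\<lambda>n. \<bar>z (Suc n)\<bar>)"
  using summable_Suc_iff[of "\<lambda>n. \<bar>z n\<bar>"] by (simp add: l1_space_def)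

lemma sum_abs_le_l1_norm:
  "z \<in> l1_space \<Longrightarrow> finite I \<Longrightarrow> (\<Sum>n\<in>I. \<bar>z n\<bar>) \<le> l1_norm z"
  unfolding l1_norm_def by (intro sum_le_suminf l1_summable) auto

lemma abs_le_l1_norm: "z \<in> l1_space \<Longrightarrow> \<bar>z n\<bar> \<le> l1_norm z"
  using sum_abs_le_l1_norm[of z "{n}"] by simp

lemma l1_norm_split_head: "z \<in> l1_space \<Longrightarrow> l1_norm z = \<bar>z 0\<bar> + (\<Sum>n. \<bar>z (Suc n)\<bar>)"
  using suminf_split_head[OF l1_summable] by (simp add: l1_norm_def)

lemma l1_boundedI:
  assumes "\<And>m. (\<Sum>n<m. \<bar>z n\<bar>) \<le> C"
  shows "z \<in> l1_space" "l1_norm z \<le> C"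
proof -
  show "z \<in> l1_space"
    unfolding l1_space_def using summableI_nonneg_bounded[of "\<lambda>n. \<bar>z n\<bar>", OF abs_ge_zero assms]
    by simp
  then show "l1_norm z \<le> C"
    unfolding l1_norm_def by (intro suminf_le_const l1_summable assms)
qed

text \<open>The limit is taken coordinatewise. The Cauchy estimate holds for every finite partial
  sum, survives the limit there, and then passes to the whole series.\<close>

lemma l1_Cauchy_converges:
  fixes \<sigma> :: "nat \<Rightarrow> nat \<Rightarrow> real"
  assumes "range \<sigma> \<subseteq> l1_space"
    and Cauchy: "\<And>e. e > 0 \<Longrightarrow> \<exists>M. \<forall>n\<ge>M. \<forall>n'\<ge>M. l1_norm (\<sigma> n - \<sigma> n') \<le> e"
  obtains z where "z \<in> l1_space" "\<And>e. e > 0 \<Longrightarrow> \<exists>M. \<forall>n\<ge>M. l1_norm (\<sigma> n - z) \<le> e"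
proof -
  have sub: "\<sigma> n - \<sigma> n' \<in> l1_space" for n n'
    using assms(1) by (intro subspace_diff[OF subspace_l1]) auto
  have "Cauchy (\<lambda>n. \<sigma> n k)" for k
    unfolding Cauchy_altdef2
  proof (intro allI impI)
    fix e :: real assume "e > 0"
    then obtain M where M: "\<forall>n\<ge>M. \<forall>n'\<ge>M. l1_norm (\<sigma> n - \<sigma> n') \<le> e / 2"
      using Cauchy[of "e / 2"] by auto
    have "dist (\<sigma> n k) (\<sigma> M k) < e" if "n \<ge> M" for n
      using M[rule_format, OF that order_refl] abs_le_l1_norm[OF sub, of n M k] \<open>e > 0\<close>
      by (simp add: dist_real_def)
    then show "\<exists>N. \<forall>n\<ge>N. dist (\<sigma> n k) (\<sigma> N k) < e" by blast
  qed
  then have "\<exists>l. (\<lambda>n. \<sigma> n k) \<longlonglongrightarrow> l" for k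
    by (simp add: Cauchy_convergent_iff convergent_def)
  then obtain z where z: "\<And>k. (\<lambda>n. \<sigma> n k) \<longlonglongrightarrow> z k"
    by metis
  have close: "\<exists>M. \<forall>n\<ge>M. \<sigma> n - z \<in> l1_space \<and> l1_norm (\<sigma> n - z) \<le> e" if "e > 0" for e
  proof -
    obtain M where M: "\<forall>n\<ge>M. \<forall>n'\<ge>M. l1_norm (\<sigma> n - \<sigma> n') \<le> e"
      using Cauchy[OF \<open>e > 0\<close>] by blast
    have "(\<Sum>k<K. \<bar>(\<sigma> n - z) k\<bar>) \<le> e" if "n \<ge> M" for n K
    proof (rule LIMSEQ_le_const2)
      show "(\<lambda>n'. \<Sum>k<K. \<bar>(\<sigma> n - \<sigma> n') k\<bar>) \<longlonglongrightarrow> (\<Sum>k<K. \<bar>(\<sigma> n - z) k\<bar>)"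
        by (auto intro!: tendsto_intros z)
      show "\<exists>N. \<forall>n'\<ge>N. (\<Sum>k<K. \<bar>(\<sigma> n - \<sigma> n') k\<bar>) \<le> e"
        using M that sum_abs_le_l1_norm[OF sub finite_lessThan] by (meson order_trans)
    qed
    then show ?thesis using l1_boundedI by blast
  qed
  show thesis
  proof
    obtain n where "\<sigma> n - z \<in> l1_space" using close[of 1] by auto
    moreover have "\<sigma> n \<in> l1_space" using assms(1) by auto
    ultimately have "\<sigma> n - (\<sigma> n - z) \<in> l1_space"
      by (rule subspace_diff[OF subspace_l1, rotated])
    then show "z \<in> l1_space" by simp
    show "\<exists>M. \<forall>n\<ge>M. l1_norm (\<sigma> n - z) \<le> e" if "e > 0" for e
      using close[OF that] by blast
  qed
qed

text \<open>Coordinate \<open>0\<close> is the extra dimension; the hyperplane where it vanishes is the copy of \<open>\<ell>\<^sub>1\<close>.\<close>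

definition bump_norm :: "(nat \<Rightarrow> real) \<Rightarrow> real" where
  "bump_norm z = max (\<Sum>n. \<bar>z (Suc n)\<bar>) (SUP n. \<bar>z 0 + z (Suc n)\<bar>)"

text \<open>The supremum is over a set bounded by \<open>l1_norm z\<close>, so it behaves as
  expected; later estimates go through this criterion instead of the supremum.\<close>

lemma bump_norm_le_iff:
  assumes "z \<in> l1_space"
  shows "bump_norm z \<le> C \<longleftrightarrow> (\<Sum>n. \<bar>z (Suc n)\<bar>) \<le> C \<and> (\<forall>n. \<bar>z 0 + z (Suc n)\<bar> \<le> C)"
proof -
  have "\<bar>z 0 + z (Suc n)\<bar> \<le> l1_norm z" for n
    using sum_abs_le_l1_norm[OF assms, of "{0, Suc n}"] by simp
  then have "bdd_above (range (\<lambda>n. \<bar>z 0 + z (Suc n)\<bar>))"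
    by (intro bdd_aboveI2)
  then show ?thesis
    by (simp add: bump_norm_def cSUP_le_iff)
qed

lemma bump_norm_lower:
  assumes "z \<in> l1_space"
  shows "(\<Sum>n. \<bar>z (Suc n)\<bar>) \<le> bump_norm z" "\<bar>z 0 + z (Suc n)\<bar> \<le> bump_norm z"
  using bump_norm_le_iff[OF assms, of "bump_norm z"] by auto

lemma bump_norm_le_l1_norm:
  assumes "z \<in> l1_space"
  shows "bump_norm z \<le> l1_norm z"
proof -
  have "\<bar>z 0 + z (Suc n)\<bar> \<le> l1_norm z" for n
    using sum_abs_le_l1_norm[OF assms, of "{0, Suc n}"] by simp
  then show ?thesis
    using l1_norm_split_head[OF assms] by (simp add: bump_norm_le_iff[OF assms])
qed

text \<open>The later coordinates tend to 0, so \<open>\<bar>z 0 + z (Suc n)\<bar>\<close> tends to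
  \<open>\<bar>z 0\<bar>\<close> and the bound survives the limit.\<close>

lemma abs_zero_coordinate_le:
  assumes "z \<in> l1_space"
  shows "\<bar>z 0\<bar> \<le> bump_norm z"
proof (rule LIMSEQ_le_const2)
  have "(\<lambda>n. z (Suc n)) \<longlonglongrightarrow> 0"
    using summable_LIMSEQ_zero[OF l1_summable_Suc[OF assms]] by (simp add: tendsto_rabs_zero_iff)
  then show "(\<lambda>n. \<bar>z 0 + z (Suc n)\<bar>) \<longlonglongrightarrow> \<bar>z 0\<bar>"
    by (auto intro!: tendsto_eq_intros)
  show "\<exists>N. \<forall>n\<ge>N. \<bar>z 0 + z (Suc n)\<bar> \<le> bump_norm z"
    using bump_norm_lower(2)[OF assms] by blast
qed

text \<open>One copy of \<open>bump_norm z\<close> pays for coordinate 0 and one for the tail. This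
  is half of the equivalence of the two norms and the source of the factors 2 below.\<close>

lemma l1_norm_le_bump_norm:
  assumes "z \<in> l1_space"
  shows "l1_norm z \<le> 2 * bump_norm z"
  using abs_zero_coordinate_le[OF assms] bump_norm_lower(1)[OF assms] l1_norm_split_head[OF assms]
  by simp

lemma bump_norm_nonneg: "z \<in> l1_space \<Longrightarrow> 0 \<le> bump_norm z"
  using abs_zero_coordinate_le[of z] by linarith

lemma normed_space_bump: "normed_space l1_space bump_norm"
proof -
  have "z = 0" if "z \<in> l1_space" "bump_norm z = 0" for z
  proof
    fix n
    show "z n = 0 n"
      using abs_le_l1_norm[OF that(1), of n] l1_norm_le_bump_norm[OF that(1)] that(2) by simp
  qed
  moreover have "bump_norm 0 = 0"
    by (simp add: bump_norm_def)
  moreover have scale_le: "bump_norm (c *\<^sub>R z) \<le> \<bar>c\<bar> * bump_norm z" if z: "z \<in> l1_space" for c z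
  proof -
    have "(\<Sum>n. \<bar>(c *\<^sub>R z) (Suc n)\<bar>) = \<bar>c\<bar> * (\<Sum>n. \<bar>z (Suc n)\<bar>)"
      using l1_summable_Suc[OF z] by (simp add: abs_mult suminf_mult)
    moreover have "\<bar>(c *\<^sub>R z) 0 + (c *\<^sub>R z) (Suc n)\<bar> = \<bar>c\<bar> * \<bar>z 0 + z (Suc n)\<bar>" for n
      by (simp flip: abs_mult add: distrib_left)
    ultimately show ?thesis
      using bump_norm_lower[OF z]
      by (simp add: bump_norm_le_iff subspace_scale[OF subspace_l1 z] mult_left_mono)
  qed
  moreover have "bump_norm (c *\<^sub>R z) = \<bar>c\<bar> * bump_norm z" if z: "z \<in> l1_space" for c z
  proof (cases "c = 0")
    case True
    then show ?thesis by (simp add: \<open>bump_norm 0 = 0\<close>)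
  next
    case False
    have "bump_norm z \<le> \<bar>1 / c\<bar> * bump_norm (c *\<^sub>R z)"
      using scale_le[OF subspace_scale[OF subspace_l1 z], of "1 / c" c] False by simp
    then show ?thesis
      using scale_le[OF z, of c] False by (simp add: field_simps)
  qed
  moreover have "bump_norm (x + y) \<le> bump_norm x + bump_norm y"
    if xy: "x \<in> l1_space" "y \<in> l1_space" for x y
  proof -
    have xy': "x + y \<in> l1_space" by (rule subspace_add[OF subspace_l1 xy])
    have "(\<Sum>n. \<bar>(x + y) (Suc n)\<bar>) \<le> (\<Sum>n. \<bar>x (Suc n)\<bar> + \<bar>y (Suc n)\<bar>)"
      by (intro suminf_le l1_summable_Suc xy' summable_add xy) auto
    also have "\<dots> = (\<Sum>n. \<bar>x (Suc n)\<bar>) + (\<Sum>n. \<bar>y (Suc n)\<bar>)"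
      by (intro suminf_add[symmetric] l1_summable_Suc xy)
    also have "\<dots> \<le> bump_norm x + bump_norm y"
      by (intro add_mono bump_norm_lower xy)
    finally have "(\<Sum>n. \<bar>(x + y) (Suc n)\<bar>) \<le> bump_norm x + bump_norm y" .
    moreover have "\<bar>(x + y) 0 + (x + y) (Suc n)\<bar> \<le> bump_norm x + bump_norm y" for n
      using bump_norm_lower(2)[OF xy(1), of n] bump_norm_lower(2)[OF xy(2), of n] by simp
    ultimately show ?thesis
      using xy' by (simp add: bump_norm_le_iff)
  qed
  ultimately show ?thesis
    using subspace_l1 bump_norm_nonneg by (auto simp: normed_space_def)
qed

section \<open>Completeness and the isomorphism with \<open>\<ell>\<^sub>1\<close>, both from
  equivalence of the norms\<close>

lemma banach_space_bump: "banach_space l1_space bump_norm"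
proof -
  interpret Metric_space l1_space "norm_dist l1_space bump_norm"
    by (rule Metric_space_norm_dist[OF normed_space_bump])
  have "\<exists>z. limitin mtopology \<sigma> z sequentially" if "MCauchy \<sigma>" for \<sigma>
  proof -
    have rng: "\<sigma> n \<in> l1_space" for n
      using that by (auto simp: MCauchy_def)
    have "\<exists>M. \<forall>n\<ge>M. \<forall>n'\<ge>M. l1_norm (\<sigma> n - \<sigma> n') \<le> e" if "e > 0" for e
    proof -
      obtain M where M: "\<And>n n'. M \<le> n \<Longrightarrow> M \<le> n' \<Longrightarrow> norm_dist l1_space bump_norm (\<sigma> n) (\<sigma> n') < e / 2"
        using \<open>MCauchy \<sigma>\<close> \<open>e > 0\<close> unfolding MCauchy_def by (meson half_gt_zero)
      have "l1_norm (\<sigma> n - \<sigma> n') \<le> e" if "M \<le> n" "M \<le> n'" for n n'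
        using M[OF that] l1_norm_le_bump_norm[OF subspace_diff[OF subspace_l1 rng rng], of n n'] rng
        by (simp add: norm_dist_def)
      then show ?thesis by blast
    qed
    then obtain z where z: "z \<in> l1_space" "\<And>e. e > 0 \<Longrightarrow> \<exists>M. \<forall>n\<ge>M. l1_norm (\<sigma> n - z) \<le> e"
      using l1_Cauchy_converges[of \<sigma>] rng by (metis image_subsetI)
    have "\<exists>M. \<forall>n\<ge>M. norm_dist l1_space bump_norm (\<sigma> n) z < e" if "e > 0" for e
    proof -
      obtain M where M: "\<forall>n\<ge>M. l1_norm (\<sigma> n - z) \<le> e / 2"
        using z(2)[OF half_gt_zero[OF \<open>e > 0\<close>]] by blast
      have "norm_dist l1_space bump_norm (\<sigma> n) z < e" if "n \<ge> M" for n
        using M that \<open>e > 0\<close> bump_norm_le_l1_norm[OF subspace_diff[OF subspace_l1 rng z(1)], of n] rng z(1)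
        by (fastforce simp: norm_dist_def)
      then show ?thesis by blast
    qed
    then show ?thesis
      using z(1) rng by (auto simp: limit_metric_sequentially)
  qed
  then show ?thesis
    using normed_space_bump by (simp add: banach_space_def mcomplete_def)
qed

lemma isomorphic_bump: "isomorphic_spaces l1_space bump_norm l1_space l1_norm"
proof -
  have "inv_into l1_space (\<lambda>x. x) z = z" if "z \<in> l1_space" for z
    using that inv_into_f_f[of "\<lambda>x. x" l1_space z] by simp
  then have "bounded_linear_on l1_space l1_norm bump_norm (inv_into l1_space (\<lambda>x. x))"
    using bump_norm_le_l1_norm
    by (auto simp: bounded_linear_on_def linear_on_def subspace_add[OF subspace_l1]
        subspace_scale[OF subspace_l1] intro!: exI[of _ 1])
  moreover have "bounded_linear_on l1_space bump_norm l1_norm (\<lambda>x. x)"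
    using l1_norm_le_bump_norm
    by (auto simp: bounded_linear_on_def linear_on_def intro!: exI[of _ 2])
  ultimately show ?thesis
    unfolding isomorphic_spaces_def by (auto simp: bij_betw_def inj_on_def intro!: exI[of _ "\<lambda>x. x"])
qed

subsection \<open>Functionals on the renormed space\<close>

definition unit_vec :: "nat \<Rightarrow> nat \<Rightarrow> real" where
  "unit_vec n = (\<lambda>k. if k = n then 1 else 0)"

definition trunc :: "nat \<Rightarrow> (nat \<Rightarrow> real) \<Rightarrow> nat \<Rightarrow> real" where
  "trunc m z = (\<lambda>n. if n < m then z n else 0)"

text \<open>The functional with coefficient sequence \<open>a\<close>. Its value 0 off
  \<open>l1_space\<close> matches the normalisation in \<open>dual_space\<close>.\<close>

definition pairing :: "(nat \<Rightarrow> real) \<Rightarrow> (nat \<Rightarrow> real) \<Rightarrow> real" where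
  "pairing a z = (if z \<in> l1_space then \<Sum>n. a n * z n else 0)"

abbreviation bump_dual :: "((nat \<Rightarrow> real) \<Rightarrow> real) set" where
  "bump_dual \<equiv> dual_space l1_space bump_norm"

abbreviation bump_dual_norm :: "((nat \<Rightarrow> real) \<Rightarrow> real) \<Rightarrow> real" where
  "bump_dual_norm \<equiv> dual_norm l1_space bump_norm"

lemma trunc_0: "trunc 0 z = 0"
  by (simp add: trunc_def fun_eq_iff)

lemma trunc_Suc: "trunc (Suc m) z = trunc m z + z m *\<^sub>R unit_vec m"
  by (auto simp: trunc_def unit_vec_def fun_eq_iff less_Suc_eq)

lemma unit_vec_l1: "unit_vec n \<in> l1_space"
  unfolding l1_space_def
  using summable_finite[of "{n}" "\<lambda>k. \<bar>unit_vec n k\<bar>"] by (auto simp: unit_vec_def)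

lemma l1_norm_unit_vec: "l1_norm (unit_vec n) = 1"
  unfolding l1_norm_def
  using suminf_finite[of "{n}" "\<lambda>k. \<bar>unit_vec n k\<bar>"] by (auto simp: unit_vec_def)

lemma bump_norm_unit_vec_le: "bump_norm (unit_vec n) \<le> 1"
  using bump_norm_le_l1_norm[OF unit_vec_l1, of n] by (simp add: l1_norm_unit_vec)

lemma trunc_l1: "trunc m z \<in> l1_space"
proof (induction m)
  case 0
  show ?case unfolding trunc_0 by (rule subspace_0[OF subspace_l1])
next
  case (Suc m)
  then show ?case unfolding trunc_Suc
    by (intro subspace_add subspace_scale unit_vec_l1 subspace_l1)
qed

text \<open>The norm of the remainder is the tail of a convergent series, that is, its sum minus a
  partial sum.\<close>

lemma l1_norm_diff_trunc:
  assumes "z \<in> l1_space"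
  shows "(\<lambda>m. l1_norm (z - trunc m z)) \<longlonglongrightarrow> 0"
proof -
  have "l1_norm (z - trunc m z) = l1_norm z - (\<Sum>n<m. \<bar>z n\<bar>)" for m
  proof -
    have "summable (\<lambda>n. \<bar>(z - trunc m z) n\<bar>)"
      using subspace_diff[OF subspace_l1 assms trunc_l1] by (rule l1_summable)
    from suminf_split_initial_segment[OF this, of m]
    have "l1_norm (z - trunc m z) = (\<Sum>n. \<bar>z (n + m)\<bar>)"
      by (simp add: l1_norm_def trunc_def)
    also have "\<dots> = l1_norm z - (\<Sum>n<m. \<bar>z n\<bar>)"
      using suminf_minus_initial_segment[OF l1_summable[OF assms]] by (simp add: l1_norm_def)
    finally show ?thesis .
  qed
  moreover have "(\<lambda>m. l1_norm z - (\<Sum>n<m. \<bar>z n\<bar>)) \<longlonglongrightarrow> l1_norm z - l1_norm z"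
    unfolding l1_norm_def by (intro tendsto_intros summable_LIMSEQ l1_summable assms)
  ultimately show ?thesis by simp
qed

lemma pairing_summable:
  assumes "\<And>n. \<bar>a n\<bar> \<le> C" "z \<in> l1_space"
  shows "summable (\<lambda>n. \<bar>a n * z n\<bar>)" "summable (\<lambda>n. a n * z n)"
proof -
  have "summable (\<lambda>n. C * \<bar>z n\<bar>)"
    by (intro summable_mult l1_summable assms(2))
  then show "summable (\<lambda>n. \<bar>a n * z n\<bar>)"
    by (rule summable_comparison_test') (auto simp: abs_mult assms(1) mult_right_mono)
  then show "summable (\<lambda>n. a n * z n)"
    by (rule summable_rabs_cancel)
qed

lemma abs_pairing_le:
  assumes "\<And>n. \<bar>a n\<bar> \<le> C" "z \<in> l1_space"
  shows "\<bar>pairing a z\<bar> \<le> C * l1_norm z"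
proof -
  note s = pairing_summable[of a, OF assms]
  have "\<bar>pairing a z\<bar> \<le> (\<Sum>n. \<bar>a n * z n\<bar>)"
    using summable_rabs[OF s(1)] assms(2) by (simp add: pairing_def)
  also have "\<dots> \<le> (\<Sum>n. C * \<bar>z n\<bar>)"
    by (intro suminf_le s summable_mult l1_summable assms(2))
      (auto simp: abs_mult assms(1) mult_right_mono)
  also have "\<dots> = C * l1_norm z"
    unfolding l1_norm_def by (intro suminf_mult l1_summable assms(2))
  finally show ?thesis .
qed

lemma pairing_add:
  assumes "\<And>n. \<bar>a n\<bar> \<le> C" "\<And>n. \<bar>b n\<bar> \<le> D"
  shows "pairing (a + b) = pairing a + pairing b"
proof
  fix z
  show "pairing (a + b) z = (pairing a + pairing b) z"
    using suminf_add[OF pairing_summable(2)[of a C z, OF assms(1)] pairing_summable(2)[of b D z, OF assms(2)]]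
    by (simp add: pairing_def distrib_right)
qed

lemma pairing_scale:
  assumes "\<And>n. \<bar>a n\<bar> \<le> C"
  shows "pairing (c *\<^sub>R a) = c *\<^sub>R pairing a"
proof
  fix z
  show "pairing (c *\<^sub>R a) z = (c *\<^sub>R pairing a) z"
    using suminf_mult[OF pairing_summable(2)[of a C z, OF assms]]
    by (simp add: pairing_def mult.assoc)
qed

lemma pairing_bound:
  assumes "\<And>n. \<bar>a n\<bar> \<le> C" "z \<in> l1_space"
  shows "\<bar>pairing a z\<bar> \<le> (2 * C) * bump_norm z"
proof -
  have "0 \<le> C" using assms(1)[of 0] by linarith
  then have "C * l1_norm z \<le> C * (2 * bump_norm z)"
    using l1_norm_le_bump_norm[OF assms(2)] by (intro mult_left_mono) auto
  then show ?thesis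
    using abs_pairing_le[of a, OF assms] by simp
qed

lemma pairing_mem_dual:
  assumes "\<And>n. \<bar>a n\<bar> \<le> C"
  shows "pairing a \<in> bump_dual"
proof (rule dual_spaceI)
  fix x y assume xy: "x \<in> l1_space" "y \<in> l1_space"
  then show "pairing a (x + y) = pairing a x + pairing a y"
    using suminf_add[OF pairing_summable(2)[of a, OF assms xy(1)] pairing_summable(2)[of a, OF assms xy(2)]]
    by (simp add: pairing_def subspace_add[OF subspace_l1] distrib_left)
next
  fix c x assume x: "x \<in> l1_space"
  then show "pairing a (c *\<^sub>R x) = c * pairing a x"
    using suminf_mult[OF pairing_summable(2)[of a, OF assms x], of c]
    by (simp add: pairing_def subspace_scale[OF subspace_l1] mult.left_commute)
qed (use pairing_bound[of a, OF assms] in \<open>auto simp: pairing_def\<close>)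

lemma dual_norm_pairing_le:
  assumes "\<And>n. \<bar>a n\<bar> \<le> C"
  shows "bump_dual_norm (pairing a) \<le> 2 * C"
proof (rule dual_norm_le[OF normed_space_bump])
  show "0 \<le> 2 * C" using assms[of 0] by linarith
qed (rule pairing_bound[of a, OF assms])

lemma pairing_unit_vec_left: "z \<in> l1_space \<Longrightarrow> pairing (unit_vec n) z = z n"
  using suminf_finite[of "{n}" "\<lambda>k. unit_vec n k * z k"] by (simp add: pairing_def unit_vec_def)

lemma pairing_unit_vec_right: "pairing a (unit_vec n) = a n"
  using suminf_finite[of "{n}" "\<lambda>k. a k * unit_vec n k"] unit_vec_l1[of n]
  by (simp add: pairing_def unit_vec_def)

lemma unit_vec_bound: "\<bar>unit_vec n k\<bar> \<le> 1"
  by (simp add: unit_vec_def)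

section \<open>Representation of bounded functionals by their coefficient sequences\<close>

lemma dual_apply_trunc:
  assumes "f \<in> bump_dual"
  shows "f (trunc m z) = (\<Sum>n<m. f (unit_vec n) * z n)"
proof (induction m)
  case 0
  have "f 0 = 0"
    using dual_space_apply(2)[OF assms, of 0 0] subspace_0[OF subspace_l1] by simp
  then show ?case
    by (simp only: trunc_0 lessThan_0 sum.empty)
next
  case (Suc m)
  have "f (trunc (Suc m) z) = f (trunc m z) + z m * f (unit_vec m)"
    using dual_space_apply(1)[OF assms trunc_l1 subspace_scale[OF subspace_l1 unit_vec_l1]]
      dual_space_apply(2)[OF assms unit_vec_l1]
    unfolding trunc_Suc by simp
  then show ?case using Suc.IH by (simp add: mult.commute)
qed

lemma abs_apply_unit_vec_le:
  assumes "f \<in> bump_dual"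
  shows "\<bar>f (unit_vec n)\<bar> \<le> bump_dual_norm f"
  using dual_norm_upper[where N = bump_norm, OF normed_space_bump assms unit_vec_l1 bump_norm_unit_vec_le] .

text \<open>Truncations of \<open>z\<close> converge to \<open>z\<close> in norm, and on a
  truncation \<open>f\<close> is determined by its values at the unit vectors. Thus the dual
  consists of pairings with bounded sequences.\<close>

lemma dual_eq_pairing:
  assumes f: "f \<in> bump_dual"
  shows "f = pairing (\<lambda>n. f (unit_vec n))"
proof
  fix z
  show "f z = pairing (\<lambda>n. f (unit_vec n)) z"
  proof (cases "z \<in> l1_space")
    case True
    have "(\<lambda>m. f z - f (trunc m z)) \<longlonglongrightarrow> 0"
    proof (rule Lim_null_comparison)
      have "\<bar>f z - f (trunc m z)\<bar> \<le> bump_dual_norm f * l1_norm (z - trunc m z)" for m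
      proof -
        have zt: "z - trunc m z \<in> l1_space"
          by (rule subspace_diff[OF subspace_l1 True trunc_l1])
        have "\<bar>f z - f (trunc m z)\<bar> \<le> bump_dual_norm f * bump_norm (z - trunc m z)"
          using dual_norm_bound[OF normed_space_bump f zt]
          by (simp add: dual_space_diff[OF normed_space_bump f True trunc_l1])
        also have "\<dots> \<le> bump_dual_norm f * l1_norm (z - trunc m z)"
          by (intro mult_left_mono bump_norm_le_l1_norm zt dual_norm_nonneg normed_space_bump f)
        finally show ?thesis .
      qed
      then show "\<forall>\<^sub>F m in sequentially. norm (f z - f (trunc m z)) \<le> bump_dual_norm f * l1_norm (z - trunc m z)"
        by simp
      show "(\<lambda>m. bump_dual_norm f * l1_norm (z - trunc m z)) \<longlonglongrightarrow> 0"
        by (intro tendsto_mult_right_zero l1_norm_diff_trunc True)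
    qed
    then have "(\<lambda>m. f (trunc m z)) \<longlonglongrightarrow> f z"
      using tendsto_diff[OF tendsto_const[of "f z"]] by fastforce
    moreover have "(\<lambda>m. f (trunc m z)) \<longlonglongrightarrow> pairing (\<lambda>n. f (unit_vec n)) z"
      using summable_LIMSEQ[OF pairing_summable(2)[OF abs_apply_unit_vec_le[OF f] True]] True
      by (simp add: dual_apply_trunc[OF f] pairing_def)
    ultimately show ?thesis by (rule LIMSEQ_unique)
  next
    case False
    then show ?thesis by (simp add: dual_space_apply(3)[OF f] pairing_def)
  qed
qed

text \<open>This is \<open>c\<^sub>0 \<oplus> \<real>\<close>: a null sequence with one further
  entry in front is again a null sequence.\<close>

definition c0_functionals :: "((nat \<Rightarrow> real) \<Rightarrow> real) set" where
  "c0_functionals = {f \<in> bump_dual. (\<lambda>n. f (unit_vec n)) \<longlonglongrightarrow> 0}"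

lemma pairing_c0:
  assumes "a \<longlonglongrightarrow> 0"
  shows "pairing a \<in> c0_functionals"
proof -
  obtain C where "\<And>n. \<bar>a n\<bar> \<le> C"
    using convergent_imp_Bseq[OF convergentI[OF assms]] by (auto simp: Bseq_def)
  then show ?thesis
    using assms pairing_mem_dual[of a C] by (simp add: c0_functionals_def pairing_unit_vec_right)
qed

lemma trunc_bound:
  assumes "\<And>n. \<bar>a n\<bar> \<le> C"
  shows "\<bar>trunc m a n\<bar> \<le> C"
  using assms[of n] by (auto simp: trunc_def)

lemma unit_vec_tendsto_0: "unit_vec m \<longlonglongrightarrow> 0"
  by (rule tendsto_eventually) (auto simp: unit_vec_def eventually_sequentially intro!: exI[of _ "Suc m"])

lemma pairing_0: "pairing 0 = 0"
  by (simp add: pairing_def fun_eq_iff)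

lemma pairing_trunc_Suc:
  "pairing (trunc (Suc m) a) = pairing (trunc m a) + a m *\<^sub>R pairing (unit_vec m)"
proof -
  have C: "\<bar>trunc m a n\<bar> \<le> l1_norm (trunc m a)" for n
    by (rule abs_le_l1_norm[OF trunc_l1])
  have D: "\<bar>(a m *\<^sub>R unit_vec m) n\<bar> \<le> \<bar>a m\<bar>" for n
    by (simp add: unit_vec_def)
  show ?thesis
    unfolding trunc_Suc pairing_add[of "trunc m a", OF C D] pairing_scale[of "unit_vec m", OF unit_vec_bound] ..
qed

text \<open>Stated for an arbitrary subspace, since it serves both \<open>c0_functionals\<close> and
  an unknown predual.\<close>

lemma pairing_trunc_mem:
  assumes "subspace Y" "\<And>n. pairing (unit_vec n) \<in> Y"
  shows "pairing (trunc m a) \<in> Y"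
proof (induction m)
  case 0
  show ?case unfolding trunc_0 pairing_0 by (rule subspace_0[OF assms(1)])
next
  case (Suc m)
  then show ?case unfolding pairing_trunc_Suc
    by (intro subspace_add subspace_scale assms)
qed

text \<open>Cutting off a null sequence late leaves uniformly small coefficients. The bound
  \<open>e / 2\<close> on them absorbs the factor 2 of \<open>dual_norm_pairing_le\<close>.\<close>

lemma c0_functional_approx:
  assumes f: "f \<in> c0_functionals" and "e > 0"
  obtains M where "\<And>m. m \<ge> M \<Longrightarrow> bump_dual_norm (f - pairing (trunc m (\<lambda>n. f (unit_vec n)))) \<le> e"
proof -
  let ?a = "\<lambda>n. f (unit_vec n)"
  have fd: "f \<in> bump_dual" and lim: "?a \<longlonglongrightarrow> 0"
    using f by (auto simp: c0_functionals_def)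
  obtain M where M: "\<And>n. n \<ge> M \<Longrightarrow> \<bar>?a n\<bar> < e / 2"
    using LIMSEQ_D[OF lim, of "e / 2"] \<open>e > 0\<close> by auto
  show thesis
  proof
    fix m assume "m \<ge> M"
    have le: "\<bar>(?a - trunc m ?a) n\<bar> \<le> e / 2" for n
      using M[of n] \<open>m \<ge> M\<close> \<open>e > 0\<close> by (cases "n < m") (auto simp: trunc_def)
    have "pairing (?a - trunc m ?a) + pairing (trunc m ?a) = pairing ((?a - trunc m ?a) + trunc m ?a)"
      by (rule pairing_add[symmetric, OF le trunc_bound[OF abs_apply_unit_vec_le[OF fd]]])
    also have "\<dots> = f"
      using dual_eq_pairing[OF fd] by simp
    finally have "f - pairing (trunc m ?a) = pairing (?a - trunc m ?a)"
      by (simp add: algebra_simps)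
    then show "bump_dual_norm (f - pairing (trunc m ?a)) \<le> e"
      using dual_norm_pairing_le[of "?a - trunc m ?a", OF le] by simp
  qed
qed

subsection \<open>The predual\<close>

lemma subspace_c0_functionals: "subspace c0_functionals"
proof (rule subspaceI)
  show "0 \<in> c0_functionals"
    using subspace_0[OF subspace_dual_space[OF normed_space_bump]] by (simp add: c0_functionals_def)
  show "f + g \<in> c0_functionals" if "f \<in> c0_functionals" "g \<in> c0_functionals" for f g
    using that subspace_add[OF subspace_dual_space[OF normed_space_bump]]
      tendsto_add[of "\<lambda>n. f (unit_vec n)" 0 sequentially "\<lambda>n. g (unit_vec n)" 0]
    by (simp add: c0_functionals_def)
  show "c *\<^sub>R f \<in> c0_functionals" if "f \<in> c0_functionals" for c f
    using that subspace_scale[OF subspace_dual_space[OF normed_space_bump]]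
      tendsto_mult_right_zero[of "\<lambda>n. f (unit_vec n)" sequentially c]
    by (simp add: c0_functionals_def)
qed

lemma c0_functionals_subset: "c0_functionals \<subseteq> bump_dual"
  by (auto simp: c0_functionals_def)

lemma normed_space_c0: "normed_space c0_functionals bump_dual_norm"
  by (rule normed_space_subset[OF normed_space_dual[OF normed_space_bump]
        c0_functionals_subset subspace_c0_functionals])

text \<open>Unit vectors have norm at most 1, so norm approximation of functionals is uniform
  approximation of coefficients, and uniform limits of null sequences are null.\<close>

lemma closedin_c0_functionals:
  "closedin (Metric_space.mtopology bump_dual (norm_dist bump_dual bump_dual_norm)) c0_functionals"
  unfolding closedin_norm_dist_iff[OF normed_space_dual[OF normed_space_bump]]
proof (intro conjI ballI impI c0_functionals_subset)
  fix f assume f: "f \<in> bump_dual" and approx: "\<forall>e>0. \<exists>g\<in>c0_functionals. bump_dual_norm (f - g) < e"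
  have "(\<lambda>n. f (unit_vec n)) \<longlonglongrightarrow> 0"
  proof (rule LIMSEQ_I)
    fix e :: real assume "e > 0"
    then obtain g where g: "g \<in> c0_functionals" "bump_dual_norm (f - g) < e / 2"
      using approx by (meson half_gt_zero)
    have fg: "f - g \<in> bump_dual"
      using subspace_diff[OF subspace_dual_space[OF normed_space_bump] f] g c0_functionals_subset by blast
    obtain M where M: "\<And>n. n \<ge> M \<Longrightarrow> \<bar>g (unit_vec n)\<bar> < e / 2"
      using g(1) LIMSEQ_D[of "\<lambda>n. g (unit_vec n)" 0 "e / 2"] \<open>e > 0\<close>
      by (auto simp: c0_functionals_def)
    have "\<bar>f (unit_vec n)\<bar> < e" if "n \<ge> M" for n
      using M[OF that] abs_apply_unit_vec_le[OF fg, of n] g(2) by simp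
    then show "\<exists>M. \<forall>n\<ge>M. norm (f (unit_vec n) - 0) < e" by auto
  qed
  with f show "f \<in> c0_functionals" by (simp add: c0_functionals_def)
qed

lemma pairing_unit_vec_c0: "pairing (unit_vec n) \<in> c0_functionals"
  by (rule pairing_c0[OF unit_vec_tendsto_0])

text \<open>The functional \<open>p\<^sub>k\<close>: the derivative of the norm at
  \<open>unit_vec 0 + unit_vec (Suc k)\<close>.\<close>

definition peak :: "nat \<Rightarrow> (nat \<Rightarrow> real) \<Rightarrow> real" where
  "peak k = pairing (unit_vec 0) + pairing (unit_vec (Suc k))"

lemma peak_apply: "z \<in> l1_space \<Longrightarrow> peak k z = z 0 + z (Suc k)"
  by (simp add: peak_def pairing_unit_vec_left)

lemma peak_c0: "peak k \<in> c0_functionals"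
  unfolding peak_def by (intro subspace_add[OF subspace_c0_functionals] pairing_unit_vec_c0)

text \<open>The bound from above is general. From below, each quantity in \<open>bump_norm\<close>
  is reached by functionals of \<open>c0_functionals\<close> with norm at most 1: the peaks for the
  supremum, finite sign sequences for the sum.\<close>

lemma dual_norm_eval_on_c0:
  assumes x: "x \<in> l1_space"
  shows "dual_norm c0_functionals bump_dual_norm (eval_on c0_functionals x) = bump_norm x"
proof (rule antisym)
  let ?D = "dual_norm c0_functionals bump_dual_norm (eval_on c0_functionals x)"
  show "?D \<le> bump_norm x"
    by (intro dual_norm_le normed_space_c0 bump_norm_nonneg x
        eval_on_bound normed_space_bump c0_functionals_subset)
  \<comment> \<open>A functional dominated by \<open>bump_norm\<close> lies in the unit ball of the
    candidate predual, so its value at \<open>x\<close> is a lower bound for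
    \<open>?D\<close>.\<close>
  have D: "\<bar>y x\<bar> \<le> ?D" if "y \<in> c0_functionals" "\<And>z. z \<in> l1_space \<Longrightarrow> \<bar>y z\<bar> \<le> bump_norm z" for y
  proof -
    have "bump_dual_norm y \<le> 1"
      using that(2) by (intro dual_norm_le normed_space_bump) auto
    then have "\<bar>eval_on c0_functionals x y\<bar> \<le> ?D"
      using that(1) by (intro dual_norm_upper normed_space_c0 eval_on_mem_dual
          normed_space_bump c0_functionals_subset subspace_c0_functionals x)
    then show ?thesis using that(1) by (simp add: eval_on_def)
  qed
  have "\<bar>x 0 + x (Suc k)\<bar> \<le> ?D" for k
    using D[OF peak_c0, of k] bump_norm_lower(2) x by (simp add: peak_apply)
  moreover have "(\<Sum>k<m. \<bar>x (Suc k)\<bar>) \<le> ?D" for m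
  proof -
    \<comment> \<open>The signs of the first \<open>m\<close> tail coordinates of \<open>x\<close>:
      pairing with \<open>x\<close> returns the partial sum, and finite support puts
      \<open>pairing a\<close> into \<open>c0_functionals\<close>.\<close>
    define a where "a n = (case n of 0 \<Rightarrow> 0 | Suc k \<Rightarrow> if k < m then sgn (x (Suc k)) else 0)" for n
    have val: "pairing a z = (\<Sum>k<m. sgn (x (Suc k)) * z (Suc k))" if "z \<in> l1_space" for z
    proof -
      have "(\<Sum>n. a n * z n) = (\<Sum>n\<in>Suc ` {..<m}. a n * z n)"
        by (intro suminf_finite) (auto simp: a_def split: nat.splits)
      then show ?thesis
        using that by (simp add: pairing_def sum.reindex a_def)
    qed
    have "a \<longlonglongrightarrow> 0"
      by (rule tendsto_eventually)
        (auto simp: a_def eventually_sequentially split: nat.splits intro!: exI[of _ "Suc m"])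
    moreover have "\<bar>pairing a z\<bar> \<le> bump_norm z" if z: "z \<in> l1_space" for z
    proof -
      have "\<bar>pairing a z\<bar> \<le> (\<Sum>k<m. \<bar>sgn (x (Suc k)) * z (Suc k)\<bar>)"
        unfolding val[OF z] by (rule sum_abs)
      also have "\<dots> \<le> (\<Sum>k<m. \<bar>z (Suc k)\<bar>)"
        by (intro sum_mono) (simp add: abs_mult sgn_if)
      also have "\<dots> \<le> (\<Sum>k. \<bar>z (Suc k)\<bar>)"
        by (intro sum_le_suminf l1_summable_Suc z) auto
      also have "\<dots> \<le> bump_norm z" by (rule bump_norm_lower(1)[OF z])
      finally show ?thesis .
    qed
    ultimately have "\<bar>pairing a x\<bar> \<le> ?D" by (intro D pairing_c0)
    then show ?thesis using val[OF x] by (simp flip: abs_sgn add: abs_mult mult.commute)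
  qed
  then have "(\<Sum>k. \<bar>x (Suc k)\<bar>) \<le> ?D"
    by (intro suminf_le_const l1_summable_Suc x)
  ultimately show "bump_norm x \<le> ?D"
    by (simp add: bump_norm_le_iff[OF x])
qed

text \<open>The duality of \<open>c\<^sub>0\<close> and \<open>\<ell>\<^sub>1\<close>: the values of
  \<open>\<phi>\<close> on the coordinate functionals form a summable sequence \<open>x\<close>, and
  \<open>\<phi>\<close> agrees with evaluation at \<open>x\<close> on the dense set of truncated
  pairings.\<close>

lemma c0_dual_eq_eval_on:
  assumes \<phi>: "\<phi> \<in> dual_space c0_functionals bump_dual_norm"
  obtains x where "x \<in> l1_space" "\<phi> = eval_on c0_functionals x"
proof -
  define x where "x n = \<phi> (pairing (unit_vec n))" for n
  let ?D = "dual_norm c0_functionals bump_dual_norm \<phi>"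
  have D0: "0 \<le> ?D" by (rule dual_norm_nonneg[OF normed_space_c0 \<phi>])
  have tr: "pairing (trunc m a) \<in> c0_functionals" for m a
    by (rule pairing_trunc_mem[OF subspace_c0_functionals pairing_unit_vec_c0])
  have val: "\<phi> (pairing (trunc m a)) = (\<Sum>n<m. a n * x n)" for m a
  proof (induction m)
    case 0
    have "\<phi> 0 = 0"
      using dual_space_apply(2)[OF \<phi>, of 0 0] subspace_0[OF subspace_c0_functionals] by simp
    then show ?case by (simp only: trunc_0 pairing_0 lessThan_0 sum.empty)
  next
    case (Suc m)
    have "\<phi> (pairing (trunc (Suc m) a)) = \<phi> (pairing (trunc m a)) + a m * x m"
      unfolding pairing_trunc_Suc x_def
      using dual_space_apply(1)[OF \<phi> tr subspace_scale[OF subspace_c0_functionals pairing_unit_vec_c0]]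
        dual_space_apply(2)[OF \<phi> pairing_unit_vec_c0] by simp
    then show ?case using Suc.IH by simp
  qed
  have "(\<Sum>n<m. \<bar>x n\<bar>) \<le> ?D * 2" for m
  proof -
    \<comment> \<open>Testing \<open>\<phi>\<close> on a truncated sign sequence, whose pairing has
      norm at most 2, bounds all partial sums.\<close>
    have "(\<Sum>n<m. \<bar>x n\<bar>) = \<phi> (pairing (trunc m (\<lambda>n. sgn (x n))))"
      unfolding val by (simp flip: abs_sgn add: mult.commute)
    also have "\<dots> \<le> ?D * bump_dual_norm (pairing (trunc m (\<lambda>n. sgn (x n))))"
      using dual_norm_bound[OF normed_space_c0 \<phi> tr] by (rule order_trans[OF abs_ge_self])
    also have "\<dots> \<le> ?D * (2 * 1)"
      by (intro mult_left_mono D0 dual_norm_pairing_le trunc_bound) (simp add: sgn_if)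
    finally show ?thesis by simp
  qed
  then have x: "x \<in> l1_space" by (rule l1_boundedI(1))
  have "\<phi> y = y x" if y: "y \<in> c0_functionals" for y
  proof -
    let ?a = "\<lambda>n. y (unit_vec n)"
    have yd: "y \<in> bump_dual" using y c0_functionals_subset by blast
    have "(\<lambda>m. \<phi> (pairing (trunc m ?a))) \<longlonglongrightarrow> \<phi> y"
    proof (rule LIMSEQ_I)
      fix e :: real assume "e > 0"
      \<comment> \<open>With \<open>?D + 1\<close> in the denominator there is no division by 0, and
        \<open>(?D + 1) * e'\<close> is \<open>e / 2\<close>, which is strictly below
        \<open>e\<close>.\<close>
      define e' where "e' = e / (2 * (?D + 1))"
      have "e' > 0" using \<open>e > 0\<close> D0 by (simp add: e'_def)
      obtain M where M: "\<And>m. m \<ge> M \<Longrightarrow> bump_dual_norm (y - pairing (trunc m ?a)) \<le> e'"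
        using c0_functional_approx[OF y \<open>e' > 0\<close>] by blast
      have "norm (\<phi> (pairing (trunc m ?a)) - \<phi> y) < e" if "m \<ge> M" for m
      proof -
        have d: "y - pairing (trunc m ?a) \<in> c0_functionals"
          by (rule subspace_diff[OF subspace_c0_functionals y tr])
        have "norm (\<phi> (pairing (trunc m ?a)) - \<phi> y) = \<bar>\<phi> (y - pairing (trunc m ?a))\<bar>"
          by (simp add: dual_space_diff[OF normed_space_c0 \<phi> y tr])
        also have "\<dots> \<le> ?D * bump_dual_norm (y - pairing (trunc m ?a))"
          by (rule dual_norm_bound[OF normed_space_c0 \<phi> d])
        also have "\<dots> \<le> (?D + 1) * e'"
          using M[OF that] D0 \<open>e' > 0\<close>
            dual_norm_nonneg[OF normed_space_bump subsetD[OF c0_functionals_subset d]]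
          by (intro mult_mono') auto
        also have "\<dots> < e" using D0 \<open>e > 0\<close> by (simp add: e'_def field_simps add_pos_nonneg)
        finally show ?thesis .
      qed
      then show "\<exists>M. \<forall>m\<ge>M. norm (\<phi> (pairing (trunc m ?a)) - \<phi> y) < e" by blast
    qed
    moreover have "(\<lambda>m. \<phi> (pairing (trunc m ?a))) \<longlonglongrightarrow> pairing ?a x"
      using summable_LIMSEQ[OF pairing_summable(2)[of ?a, OF abs_apply_unit_vec_le[OF yd] x]] x
      by (simp add: val pairing_def)
    moreover have "pairing ?a x = y x"
      using dual_eq_pairing[OF yd] by simp
    ultimately show ?thesis using LIMSEQ_unique by metis
  qed
  then have "\<phi> = eval_on c0_functionals x"
    using dual_space_apply(3)[OF \<phi>] by (auto simp: eval_on_def)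
  with x show thesis by (rule that)
qed

lemma is_predual_c0: "is_predual l1_space bump_norm c0_functionals"
  unfolding is_predual_def surj_linear_isometry_def
proof (intro conjI c0_functionals_subset subspace_c0_functionals closedin_c0_functionals ballI
    dual_norm_eval_on_c0)
  show "linear_on l1_space (eval_on c0_functionals)"
    using dual_space_apply[OF subsetD[OF c0_functionals_subset]]
    by (auto simp: linear_on_def eval_on_def fun_eq_iff)
  show "eval_on c0_functionals ` l1_space = dual_space c0_functionals bump_dual_norm"
    using c0_dual_eq_eval_on eval_on_mem_dual[OF normed_space_bump c0_functionals_subset subspace_c0_functionals]
    by blast
qed

subsection \<open>Uniqueness of the predual\<close>

text \<open>
  At \<open>unit_vec 0 + unit_vec (Suc k)\<close> the term \<open>\<bar>z 0 + z (Suc k)\<bar>\<close> of the norm exceeds all the others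
  by \<open>1\<close>, so the norm is affine on a ball around that point. Hence it is Frechet differentiable there,
  and a norming closed subspace contains the derivative.
\<close>

lemma peak_mem_predual:
  assumes Y: "is_predual l1_space bump_norm Y"
  shows "peak k \<in> Y"
proof (rule predual_closed[OF normed_space_bump Y])
  show pd: "peak k \<in> bump_dual" using peak_c0 c0_functionals_subset by blast
  fix e :: real assume "e > 0"
  define w where "w = unit_vec 0 + unit_vec (Suc k)"
  have w: "w \<in> l1_space"
    unfolding w_def by (intro subspace_add[OF subspace_l1] unit_vec_l1)
  have w0: "w 0 = 1" and wS: "w (Suc n) = (if n = k then 1 else 0)" for n
    by (simp_all add: w_def unit_vec_def)
  have sumw: "(\<Sum>n. \<bar>w (Suc n)\<bar>) = 1"
    using suminf_finite[of "{k}" "\<lambda>n. \<bar>w (Suc n)\<bar>"] by (simp add: wS)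
  have Nw: "bump_norm w \<ge> 2"
    using bump_norm_lower(2)[OF w, of k] by (simp add: w0 wS)
  \<comment> \<open>An almost norming functional at \<open>w\<close>; the rest of the proof shows
    that it is within \<open>e\<close> of \<open>peak k\<close>.\<close>
  obtain y where y: "y \<in> Y" "bump_dual_norm y \<le> 1" "y w \<ge> bump_norm w - e / 2"
    using predual_norming[OF normed_space_bump Y w, of "e / 2"] \<open>e > 0\<close> by auto
  have yd: "y \<in> bump_dual" using y(1) Y by (auto simp: is_predual_def)
  have key: "y z \<le> peak k z + e" if z: "z \<in> l1_space" "bump_norm z \<le> 1" for z
  proof -
    \<comment> \<open>Radius 1/2 suffices: after perturbing \<open>w\<close> by \<open>?z\<close>,
      the sum and the terms with \<open>n \<noteq> k\<close> are at most 3/2, while the term at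
      \<open>k\<close> is \<open>2 + peak k z / 2\<close>, which is at least 3/2.\<close>
    let ?z = "(1 / 2) *\<^sub>R z"
    have zh: "?z \<in> l1_space" by (rule subspace_scale[OF subspace_l1 z(1)])
    have wz: "w + ?z \<in> l1_space" by (rule subspace_add[OF subspace_l1 w zh])
    have pz: "\<bar>z 0 + z (Suc n)\<bar> \<le> 1" for n
      using bump_norm_lower(2)[OF z(1), of n] z(2) by linarith
    have "bump_norm (w + ?z) \<le> 2 + peak k z / 2"
      unfolding bump_norm_le_iff[OF wz]
    proof (intro conjI allI)
      have "(\<Sum>n. \<bar>(w + ?z) (Suc n)\<bar>) \<le> (\<Sum>n. \<bar>w (Suc n)\<bar> + \<bar>?z (Suc n)\<bar>)"
        by (intro suminf_le summable_add l1_summable_Suc w zh wz) auto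
      also have "\<dots> = (\<Sum>n. \<bar>w (Suc n)\<bar>) + (\<Sum>n. \<bar>?z (Suc n)\<bar>)"
        by (intro suminf_add[symmetric] l1_summable_Suc w zh)
      also have "(\<Sum>n. \<bar>?z (Suc n)\<bar>) = (1 / 2) * (\<Sum>n. \<bar>z (Suc n)\<bar>)"
        using suminf_mult[OF l1_summable_Suc[OF z(1)], of "1 / 2"] by (simp add: abs_mult)
      also have "(\<Sum>n. \<bar>z (Suc n)\<bar>) \<le> 1"
        by (rule order_trans[OF bump_norm_lower(1)[OF z(1)] z(2)])
      finally have "(\<Sum>n. \<bar>(w + ?z) (Suc n)\<bar>) \<le> 3 / 2"
        by (simp add: sumw)
      also have "3 / 2 \<le> 2 + peak k z / 2"
        using abs_le_D2[OF pz[of k]] by (simp add: peak_apply[OF z(1)] field_simps)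
      finally show "(\<Sum>n. \<bar>(w + ?z) (Suc n)\<bar>) \<le> 2 + peak k z / 2" by simp
      show "\<bar>(w + ?z) 0 + (w + ?z) (Suc n)\<bar> \<le> 2 + peak k z / 2" for n
        using pz[of n] pz[of k]
        by (cases "n = k") (auto simp: peak_apply[OF z(1)] w0 wS abs_le_iff field_simps)
    qed
    moreover have "\<bar>y (w + ?z)\<bar> \<le> bump_norm (w + ?z)"
      using dual_norm_bound[OF normed_space_bump yd wz] y(2)
        mult_right_mono[OF y(2) bump_norm_nonneg[OF wz]] by linarith
    moreover have "y (w + ?z) = y w + y z / 2"
      using dual_space_apply(1)[OF yd w zh] dual_space_apply(2)[OF yd z(1), of "1 / 2"] by simp
    \<comment> \<open>Since \<open>y w \<ge> 2 - e / 2\<close>, what is left is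
      \<open>y z / 2 \<le> peak k z / 2 + e / 2\<close>.\<close>
    ultimately show ?thesis using y(3) Nw by linarith
  qed
  \<comment> \<open>The one-sided estimate at \<open>z\<close> and at \<open>-z\<close> gives the
    two-sided one.\<close>
  have "\<bar>(peak k - y) z\<bar> \<le> e" if z: "z \<in> l1_space" "bump_norm z \<le> 1" for z
  proof -
    have mz: "(-1) *\<^sub>R z \<in> l1_space" by (rule subspace_scale[OF subspace_l1 z(1)])
    have "bump_norm ((-1) *\<^sub>R z) = \<bar>-1\<bar> * bump_norm z"
      using normed_space_bump z(1) unfolding normed_space_def by blast
    then have "bump_norm ((-1) *\<^sub>R z) \<le> 1" using z(2) by simp
    from key[OF mz this] key[OF z]
    show ?thesis
      using dual_space_apply(2)[OF yd z(1), of "-1"] dual_space_apply(2)[OF pd z(1), of "-1"]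
      by auto
  qed
  then have "bump_dual_norm (peak k - y) \<le> e"
    unfolding dual_norm_def op_norm_def
    using normed_space_zero[OF normed_space_bump] by (intro cSUP_least) force+
  with y(1) show "\<exists>g\<in>Y. bump_dual_norm (peak k - g) \<le> e" by blast
qed

text \<open>The mean of \<open>m\<close> peaks differs from coordinate 0 by the mean of
  \<open>m\<close> tail coordinates, which is at most \<open>bump_norm z / m\<close>. Closedness
  yields coordinate 0, and subtracting it from the peaks yields the others.\<close>

lemma pairing_unit_vec_mem_predual:
  assumes Y: "is_predual l1_space bump_norm Y"
  shows "pairing (unit_vec n) \<in> Y"
proof -
  have sY: "subspace Y" using Y by (simp add: is_predual_def)
  have avg: "\<exists>g\<in>Y. \<forall>z\<in>l1_space. g z = real m * z 0 + (\<Sum>k<m. z (Suc k))" for m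
  proof (induction m)
    case 0
    show ?case using subspace_0[OF sY] by (intro bexI[of _ 0]) auto
  next
    case (Suc m)
    then obtain g where g: "g \<in> Y" "\<forall>z\<in>l1_space. g z = real m * z 0 + (\<Sum>k<m. z (Suc k))" by blast
    then show ?case
      using subspace_add[OF sY g(1) peak_mem_predual[OF Y, of m]]
      by (intro bexI[of _ "g + peak m"]) (auto simp: peak_apply algebra_simps)
  qed
  have 0: "pairing (unit_vec 0) \<in> Y"
  proof (rule predual_closed[OF normed_space_bump Y])
    show "pairing (unit_vec 0) \<in> bump_dual" by (rule pairing_mem_dual[OF unit_vec_bound])
    fix e :: real assume "e > 0"
    then obtain m where m: "1 / real (Suc m) < e"
      using nat_approx_posE by metis
    obtain g where g: "g \<in> Y" "\<forall>z\<in>l1_space. g z = real (Suc m) * z 0 + (\<Sum>k<Suc m. z (Suc k))"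
      using avg by blast
    let ?g = "(1 / real (Suc m)) *\<^sub>R g"
    have "bump_dual_norm (pairing (unit_vec 0) - ?g) \<le> 1 / real (Suc m)"
    proof (rule dual_norm_le[OF normed_space_bump])
      fix z assume z: "z \<in> l1_space"
      have "(pairing (unit_vec 0) - ?g) z = - (1 / real (Suc m)) * (\<Sum>k<Suc m. z (Suc k))"
        using z g(2) by (simp add: pairing_unit_vec_left field_simps del: sum.lessThan_Suc of_nat_Suc)
      then have "\<bar>(pairing (unit_vec 0) - ?g) z\<bar> = 1 / real (Suc m) * \<bar>\<Sum>k<Suc m. z (Suc k)\<bar>"
        by (simp add: abs_mult del: sum.lessThan_Suc of_nat_Suc)
      also have "\<bar>\<Sum>k<Suc m. z (Suc k)\<bar> \<le> (\<Sum>k<Suc m. \<bar>z (Suc k)\<bar>)" by (rule sum_abs)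
      also have "\<dots> \<le> (\<Sum>k. \<bar>z (Suc k)\<bar>)" by (intro sum_le_suminf l1_summable_Suc z) auto
      also have "\<dots> \<le> bump_norm z" by (rule bump_norm_lower(1)[OF z])
      finally show "\<bar>(pairing (unit_vec 0) - ?g) z\<bar> \<le> 1 / real (Suc m) * bump_norm z"
        by (simp only: mult_left_mono of_nat_0_le_iff zero_le_divide_1_iff)
    qed simp
    with m have "bump_dual_norm (pairing (unit_vec 0) - ?g) \<le> e" by linarith
    then show "\<exists>g\<in>Y. bump_dual_norm (pairing (unit_vec 0) - g) \<le> e"
      using subspace_scale[OF sY g(1)] by blast
  qed
  show ?thesis
  proof (cases n)
    case (Suc k)
    have "peak k - pairing (unit_vec 0) \<in> Y"
      by (rule subspace_diff[OF sY peak_mem_predual[OF Y] 0])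
    then show ?thesis by (simp add: peak_def Suc)
  qed (use 0 in simp)
qed

text \<open>A closed subspace containing the coordinate functionals contains the norm limits of
  their finite combinations.\<close>

lemma c0_functionals_subset_predual:
  assumes Y: "is_predual l1_space bump_norm Y"
  shows "c0_functionals \<subseteq> Y"
proof
  fix f assume f: "f \<in> c0_functionals"
  have sY: "subspace Y" using Y by (simp add: is_predual_def)
  show "f \<in> Y"
  proof (rule predual_closed[OF normed_space_bump Y])
    show "f \<in> bump_dual" using f c0_functionals_subset by blast
    show "\<exists>g\<in>Y. bump_dual_norm (f - g) \<le> e" if "e > 0" for e
      using c0_functional_approx[OF f that] pairing_trunc_mem[OF sY pairing_unit_vec_mem_predual[OF Y]]
      by (metis order_refl)
  qed
qed

text \<open>
  A functional in \<open>Y\<close> outside \<open>c0_functionals\<close> would be detected by a weak* cluster point of the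
  unit vectors; such a cluster point is evaluation at some \<open>x\<close>, but all coordinates of \<open>x\<close> vanish.
\<close>

lemma predual_subset_c0_functionals:
  assumes Y: "is_predual l1_space bump_norm Y"
  shows "Y \<subseteq> c0_functionals"
proof
  fix f assume f: "f \<in> Y"
  have Yd: "Y \<subseteq> bump_dual" and sY: "subspace Y"
    and surj: "eval_on Y ` l1_space = dual_space Y bump_dual_norm"
    using Y by (auto simp: is_predual_def surj_linear_isometry_def)
  show "f \<in> c0_functionals"
  proof (rule ccontr)
    assume "f \<notin> c0_functionals"
    then have "\<not> (\<lambda>n. f (unit_vec n)) \<longlonglongrightarrow> 0"
      using f Yd by (auto simp: c0_functionals_def)
    then obtain d where d: "d > 0" "\<And>M. \<exists>n\<ge>M. \<bar>f (unit_vec n)\<bar> \<ge> d"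
      unfolding LIMSEQ_iff by (auto simp: not_less)
    \<comment> \<open>Evaluations at the unit vectors, along only those indices where
      \<open>f\<close> stays away from 0; there are arbitrarily large ones, so the filter is
      proper.\<close>
    define F where "F = filtermap (\<lambda>n. eval_on Y (unit_vec n))
      (inf sequentially (principal {n. \<bar>f (unit_vec n)\<bar> \<ge> d}))"
    \<comment> \<open>A product of compact intervals over all functions \<open>y\<close>. The
      absolute values ensure that 0 lies in each interval, as \<open>eval_on\<close> demands for
      \<open>y\<close> outside \<open>Y\<close>.\<close>
    define K where "K = PiE UNIV (\<lambda>y. {- \<bar>bump_dual_norm y\<bar>..\<bar>bump_dual_norm y\<bar>})"
    have ev: "eventually P F" if "\<And>n. n \<ge> M \<Longrightarrow> \<bar>f (unit_vec n)\<bar> \<ge> d \<Longrightarrow> P (eval_on Y (unit_vec n))" for P M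
      using that unfolding F_def eventually_filtermap eventually_inf_principal eventually_sequentially
      by blast
    have "\<not> eventually (\<lambda>_. False) F"
      unfolding F_def eventually_filtermap eventually_inf_principal eventually_sequentially
      using d(2) by auto
    then have "F \<noteq> bot" by auto
    moreover have "compact K"
      unfolding K_def compactin_euclidean_iff[symmetric] euclidean_product_topology[symmetric] compactin_PiE
      by simp
    moreover have "eventually (\<lambda>\<psi>. \<psi> \<in> K) F"
    proof (rule ev)
      fix n
      show "eval_on Y (unit_vec n) \<in> K"
        using abs_apply_unit_vec_le[OF subsetD[OF Yd], of _ n]
        by (fastforce simp: K_def eval_on_def abs_le_iff)
    qed
    ultimately obtain \<phi> where \<phi>: "\<phi> \<in> K" "inf (nhds \<phi>) F \<noteq> bot"
      unfolding compact_filter by blast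
    \<comment> \<open>Refining \<open>F\<close> by the neighbourhoods of the cluster point turns
      clustering into convergence of every coordinate, while all eventual properties of
      \<open>F\<close> persist.\<close>
    define G where "G = inf (nhds \<phi>) F"
    have G: "G \<noteq> bot" using \<phi>(2) by (simp add: G_def)
    have evG: "eventually P G" if "eventually P F" for P
      using filter_leD[OF inf_le2 that] by (simp add: G_def)
    have lim: "((\<lambda>\<psi>. \<psi> y) \<longlongrightarrow> \<phi> y) G" for y
    proof -
      have "((\<lambda>\<psi>. \<psi> y) \<longlongrightarrow> \<phi> y) (nhds \<phi>)"
      proof (rule topological_tendstoI)
        fix S assume "open S" "\<phi> y \<in> S"
        moreover have "open ((\<lambda>\<psi>. \<psi> y) -` S)"
          by (rule open_vimage[OF \<open>open S\<close> continuous_on_product_coordinates])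
        ultimately show "eventually (\<lambda>\<psi>. \<psi> y \<in> S) (nhds \<phi>)"
          unfolding eventually_nhds by (intro exI[of _ "(\<lambda>\<psi>. \<psi> y) -` S"]) auto
      qed
      then show ?thesis unfolding G_def by (rule tendsto_mono[OF inf_le1])
    qed
    have const: "\<phi> y = c" if "eventually (\<lambda>\<psi>. \<psi> y = c) F" for y c
      using tendsto_unique[OF G lim tendsto_eventually[OF evG[OF that]]] .
    \<comment> \<open>Linearity and vanishing off \<open>Y\<close> hold for each evaluation and pass
      to the limit along \<open>G\<close>; the norm bound is membership in \<open>K\<close>.\<close>
    have "\<phi> \<in> dual_space Y bump_dual_norm"
    proof (rule dual_spaceI[where C = 1])
      fix y y' assume yy: "y \<in> Y" "y' \<in> Y"
      have "eventually (\<lambda>\<psi>. \<psi> (y + y') = \<psi> y + \<psi> y') G"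
        by (rule evG, rule ev) (use yy subspace_add[OF sY] in \<open>auto simp: eval_on_def\<close>)
      from tendsto_cong[THEN iffD1, OF this lim] show "\<phi> (y + y') = \<phi> y + \<phi> y'"
        using tendsto_unique[OF G _ tendsto_add[OF lim lim]] by blast
    next
      fix c y assume y: "y \<in> Y"
      have "eventually (\<lambda>\<psi>. \<psi> (c *\<^sub>R y) = c * \<psi> y) G"
        by (rule evG, rule ev) (use y subspace_scale[OF sY] in \<open>auto simp: eval_on_def\<close>)
      from tendsto_cong[THEN iffD1, OF this lim] show "\<phi> (c *\<^sub>R y) = c * \<phi> y"
        using tendsto_unique[OF G _ tendsto_mult[OF tendsto_const lim]] by blast
    next
      fix y assume y: "y \<in> Y"
      have "\<phi> y \<in> {- \<bar>bump_dual_norm y\<bar>..\<bar>bump_dual_norm y\<bar>}"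
        using \<phi>(1) by (auto simp: K_def)
      then show "\<bar>\<phi> y\<bar> \<le> 1 * bump_dual_norm y"
        using dual_norm_nonneg[OF normed_space_bump subsetD[OF Yd y]] by auto
    next
      fix y assume "y \<notin> Y"
      then show "\<phi> y = 0" by (intro const ev) (simp add: eval_on_def)
    qed
    then obtain x where x: "x \<in> l1_space" "\<phi> = eval_on Y x"
      using surj by blast
    have "x k = 0" for k
    proof -
      \<comment> \<open>Every unit vector with index at least \<open>Suc k\<close> has coordinate
        \<open>k\<close> equal to 0. This determines \<open>x\<close>, because the coordinate
        functionals belong to \<open>Y\<close>.\<close>
      have "\<phi> (pairing (unit_vec k)) = 0"
        by (rule const, rule ev[of "Suc k"])
          (simp add: eval_on_def pairing_unit_vec_right unit_vec_def[of k])
      then show ?thesis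
        using x pairing_unit_vec_mem_predual[OF Y, of k] by (simp add: eval_on_def pairing_unit_vec_left)
    qed
    then have "x = 0" by auto
    then have "\<phi> f = 0"
      using f x dual_space_apply(2)[OF subsetD[OF Yd f] x(1), of 0] by (simp add: eval_on_def)
    \<comment> \<open>The indices in \<open>F\<close> were chosen with
      \<open>\<bar>f (unit_vec n)\<bar> \<ge> d\<close>, and this lower bound survives the
      limit.\<close>
    moreover have "\<bar>\<phi> f\<bar> \<ge> d"
    proof (rule tendsto_lowerbound[OF tendsto_rabs[OF lim] _ G])
      show "eventually (\<lambda>\<psi>. d \<le> \<bar>\<psi> f\<bar>) G"
        by (rule evG, rule ev) (use f in \<open>simp add: eval_on_def\<close>)
    qed
    ultimately show False using d(1) by simp
  qed
qed

lemma strongly_unique_predual_bump: "has_strongly_unique_predual l1_space bump_norm"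
  unfolding has_strongly_unique_predual_def
  using is_predual_c0 c0_functionals_subset_predual predual_subset_c0_functionals by blast

subsection \<open>The hyperplane isometric to \<open>\<ell>\<^sub>1\<close>\<close>

definition hyperplane :: "(nat \<Rightarrow> real) set" where
  "hyperplane = {z \<in> l1_space. z 0 = 0}"

lemma subspace_hyperplane: "subspace hyperplane"
  using subspace_l1 by (auto simp: hyperplane_def subspace_def)

text \<open>With coordinate 0 gone, each term of the supremum is a single summand of the series and
  is dominated by it.\<close>

lemma bump_norm_hyperplane:
  assumes "z \<in> hyperplane"
  shows "bump_norm z = (\<Sum>n. \<bar>z (Suc n)\<bar>)"
proof (rule antisym)
  have z: "z \<in> l1_space" "z 0 = 0" using assms by (auto simp: hyperplane_def)
  have "\<bar>z (Suc n)\<bar> \<le> (\<Sum>n. \<bar>z (Suc n)\<bar>)" for n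
    using sum_le_suminf[OF l1_summable_Suc[OF z(1)], of "{n}"] by simp
  then show "bump_norm z \<le> (\<Sum>n. \<bar>z (Suc n)\<bar>)"
    by (simp add: bump_norm_le_iff z)
  show "(\<Sum>n. \<bar>z (Suc n)\<bar>) \<le> bump_norm z"
    by (rule bump_norm_lower(1)[OF z(1)])
qed

text \<open>The hyperplane is the kernel of coordinate 0, which belongs to the predual, so its
  complement is a subbasic open set.\<close>

lemma closedin_hyperplane: "closedin (weak_star_topology l1_space c0_functionals) hyperplane"
proof -
  let ?T = "weak_star_topology l1_space c0_functionals"
  have op: "openin ?T {x \<in> l1_space. y x \<in> U}" if "y \<in> c0_functionals" "open U" for y U
    unfolding weak_star_topology_def using that by (intro topology_generated_by_Basis) blast
  have "topspace ?T = l1_space"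
  proof
    show "topspace ?T \<subseteq> l1_space"
      unfolding weak_star_topology_def topology_generated_by_topspace by blast
    show "l1_space \<subseteq> topspace ?T"
      using openin_subset[OF op[OF pairing_unit_vec_c0 open_UNIV, of 0]] by simp
  qed
  moreover have "l1_space - hyperplane = {x \<in> l1_space. pairing (unit_vec 0) x \<in> - {0}}"
    by (auto simp: hyperplane_def pairing_unit_vec_left)
  ultimately show ?thesis
    using op[OF pairing_unit_vec_c0, of "- {0}" 0] by (auto simp: closedin_def hyperplane_def)
qed

definition drop_zero :: "(nat \<Rightarrow> real) \<Rightarrow> nat \<Rightarrow> real" where
  "drop_zero z = z - z 0 *\<^sub>R unit_vec 0"

lemma drop_zero_mem: "z \<in> l1_space \<Longrightarrow> drop_zero z \<in> hyperplane"
  unfolding drop_zero_def hyperplane_def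
  using subspace_diff[OF subspace_l1 _ subspace_scale[OF subspace_l1 unit_vec_l1], of z "z 0" 0]
  by (simp add: unit_vec_def[of 0])

lemma drop_zero_hyperplane: "z \<in> hyperplane \<Longrightarrow> drop_zero z = z"
  by (simp add: drop_zero_def hyperplane_def)

text \<open>The projection leaves the sum in the norm unchanged, and on the hyperplane that sum is
  the whole norm.\<close>

lemma bump_norm_drop_zero_le:
  assumes "z \<in> l1_space"
  shows "bump_norm (drop_zero z) \<le> bump_norm z"
proof -
  have "bump_norm (drop_zero z) = (\<Sum>n. \<bar>z (Suc n)\<bar>)"
    unfolding bump_norm_hyperplane[OF drop_zero_mem[OF assms]] by (simp add: drop_zero_def unit_vec_def)
  then show ?thesis using bump_norm_lower(1)[OF assms] by simp
qed

lemma one_complemented_hyperplane: "one_complemented l1_space bump_norm hyperplane"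
  unfolding one_complemented_def
proof (intro exI[of _ drop_zero] conjI ballI)
  have "linear_on l1_space drop_zero"
    by (auto simp: linear_on_def drop_zero_def algebra_simps)
  then show "bounded_linear_on l1_space bump_norm bump_norm drop_zero"
    unfolding bounded_linear_on_def
    using bump_norm_drop_zero_le by (auto intro!: exI[of _ 1])
  show "hyperplane \<subseteq> l1_space" by (auto simp: hyperplane_def)
  then show "drop_zero ` l1_space = hyperplane"
    using drop_zero_mem drop_zero_hyperplane by (force simp: image_def)
  show "drop_zero (drop_zero z) = drop_zero z" if "z \<in> l1_space" for z
    by (rule drop_zero_hyperplane[OF drop_zero_mem[OF that]])
  show "op_norm l1_space bump_norm bump_norm drop_zero = 1"
    unfolding op_norm_def
  proof (rule cSup_eq_maximum)
    \<comment> \<open>A norm 1 vector fixed by the projection, at which the operator norm is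
      attained.\<close>
    have u: "unit_vec (Suc 0) \<in> hyperplane"
      using unit_vec_l1[of "Suc 0"] by (simp add: hyperplane_def unit_vec_def)
    have "bump_norm (unit_vec (Suc 0)) = 1"
      unfolding bump_norm_hyperplane[OF u]
      using suminf_finite[of "{0}" "\<lambda>n. \<bar>unit_vec (Suc 0) (Suc n)\<bar>"] by (simp add: unit_vec_def)
    then show "1 \<in> (\<lambda>x. bump_norm (drop_zero x)) ` {x \<in> l1_space. bump_norm x \<le> 1}"
      using drop_zero_hyperplane[OF u] unit_vec_l1[of "Suc 0"]
      by (intro image_eqI[of _ _ "unit_vec (Suc 0)"]) auto
    show "t \<le> 1" if "t \<in> (\<lambda>x. bump_norm (drop_zero x)) ` {x \<in> l1_space. bump_norm x \<le> 1}" for t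
      using that bump_norm_drop_zero_le by force
  qed
qed

lemma has_codimension_hyperplane: "has_codimension l1_space hyperplane 1"
  unfolding has_codimension_def
proof (intro conjI exI[of _ "{unit_vec 0}"] subspace_hyperplane)
  show "hyperplane \<subseteq> l1_space" by (auto simp: hyperplane_def)
  have "unit_vec 0 0 = 1" by (simp add: unit_vec_def)
  then have "unit_vec 0 \<noteq> 0" by (metis zero_fun_apply zero_neq_one)
  then show "independent {unit_vec 0}" by simp
  show "hyperplane \<inter> span {unit_vec 0} = {0}"
    using \<open>unit_vec 0 0 = 1\<close> subspace_0[OF subspace_hyperplane] span_0
    by (auto simp: hyperplane_def span_singleton)
  show "span (hyperplane \<union> {unit_vec 0}) = l1_space"
  proof
    show "span (hyperplane \<union> {unit_vec 0}) \<subseteq> l1_space"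
      by (rule span_minimal) (auto simp: hyperplane_def unit_vec_l1 subspace_l1)
    show "l1_space \<subseteq> span (hyperplane \<union> {unit_vec 0})"
    proof
      fix z assume "z \<in> l1_space"
      then have "drop_zero z + z 0 *\<^sub>R unit_vec 0 \<in> span (hyperplane \<union> {unit_vec 0})"
        by (intro span_add span_scale span_base) (auto simp: drop_zero_mem)
      then show "z \<in> span (hyperplane \<union> {unit_vec 0})" by (simp add: drop_zero_def)
    qed
  qed
qed auto

text \<open>The isometry deletes coordinate 0 by a shift; prepending 0 inverts it.\<close>

lemma isometric_hyperplane: "isometric_spaces hyperplane bump_norm l1_space l1_norm"
  unfolding isometric_spaces_def surj_linear_isometry_def
proof (intro exI[of _ "\<lambda>z n. z (Suc n)"] conjI ballI)
  show "linear_on hyperplane (\<lambda>z n. z (Suc n))"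
    by (auto simp: linear_on_def fun_eq_iff)
  show "l1_norm (\<lambda>n. z (Suc n)) = bump_norm z" if "z \<in> hyperplane" for z
    by (simp add: bump_norm_hyperplane[OF that] l1_norm_def)
  show "(\<lambda>z n. z (Suc n)) ` hyperplane = l1_space"
  proof
    show "(\<lambda>z n. z (Suc n)) ` hyperplane \<subseteq> l1_space"
      by (auto simp: hyperplane_def l1_space_def summable_Suc_iff[of "\<lambda>n. \<bar>z n\<bar>" for z])
    show "l1_space \<subseteq> (\<lambda>z n. z (Suc n)) ` hyperplane"
    proof
      fix x assume x: "x \<in> l1_space"
      let ?z = "case_nat 0 x"
      have "?z \<in> hyperplane"
        using x summable_Suc_iff[of "\<lambda>n. \<bar>?z n\<bar>"] by (simp add: hyperplane_def l1_space_def)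
      then show "x \<in> (\<lambda>z n. z (Suc n)) ` hyperplane"
        by (intro image_eqI[of _ _ ?z]) auto
    qed
  qed
qed

theorem theorem1:
  shows "\<exists>(X :: (nat \<Rightarrow> real) set) (N :: (nat \<Rightarrow> real) \<Rightarrow> real).
    banach_space X N \<and>
    isomorphic_spaces X N l1_space l1_norm \<and>
    has_strongly_unique_predual X N \<and>
    (\<exists>Y V. is_predual X N Y \<and>
       subspace V \<and> V \<subseteq> X \<and>
       closedin (weak_star_topology X Y) V \<and>
       one_complemented X N V \<and>
       has_codimension X V 1 \<and>
       isometric_spaces V N l1_space l1_norm)"
\<comment> \<open>Unification fixes the witnesses: \<open>l1_space\<close> with
  \<open>bump_norm\<close>, the predual \<open>c0_functionals\<close> and the subspace
  \<open>hyperplane\<close>.\<close>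
proof (intro exI conjI)
  show "hyperplane \<subseteq> l1_space" by (auto simp: hyperplane_def)
qed (rule banach_space_bump isomorphic_bump strongly_unique_predual_bump is_predual_c0
      subspace_hyperplane closedin_hyperplane one_complemented_hyperplane
      has_codimension_hyperplane isometric_hyperplane)+

end
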